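(* For every $\sigma\in(0,1)$, there exist constant uniformly elliptic, nonproportional matrices $A_+,A_-\in\mathcal{S}^4$ and a nonzero function \[q\in C^\sigma_{\mathrm{loc}}(\mathbb{R}^4)\cap W^{1,2}_{\mathrm{loc}}(\mathbb{R}^4),\] homogeneous of degree $\sigma$, such that \[\operatorname{div}\bigl(A_+\nabla q^+-A_-\nabla q^-\bigr)=0\qquad\text{in }\mathbb{R}^4\] in the sense of distributions. Moreover, writing points of $\mathbb{R}^4$ as $(x,y)\in\mathbb{R}^2\times\mathbb{R}^2$, \[\{q=0\}=\{(x,y)\in\mathbb{R}^2\times\mathbb{R}^2:|x|=|y|\},\qquad q\in C^1(\mathbb{R}^4\setminus\{0\}),\] and $q$ is not $C^\beta$ at the origin for any $\beta>\sigma$.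
   Context: $\mathcal{S}^4$ denotes the space of real symmetric $4\times4$ matrices; $A\in\mathcal{S}^4$ is uniformly elliptic if $\lambda\,\mathrm{Id}_4\le A\le\Lambda\,\mathrm{Id}_4$ for some $0<\lambda\le\Lambda$. For a real function $q$, $q^+:=\max\{q,0\}$ and $q^-:=\max\{-q,0\}$. A function $q$ is homogeneous of degree $\sigma$ if $q(tz)=t^\sigma q(z)$ for all $t>0$, $z\in\mathbb{R}^4$. "$q$ is not $C^\beta$ at the origin" means that there are no constants $C,r>0$ such that $|q(z)-q(0)|\le C|z|^\beta$ for all $|z|<r$. *)

theory Defs
  imports "HOL-Analysis.Analysis"
begin

definition symmetric_matrix :: "real^'n^'n \<Rightarrow> bool" where
  "symmetric_matrix A \<longleftrightarrow> transpose A = A"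

definition loewner_le :: "real^'n^'n \<Rightarrow> real^'n^'n \<Rightarrow> bool" where
  "loewner_le A B \<longleftrightarrow> (\<forall>\<xi>. \<xi> \<bullet> (A *v \<xi>) \<le> \<xi> \<bullet> (B *v \<xi>))"

definition uniformly_elliptic :: "real^'n^'n \<Rightarrow> bool" where
  "uniformly_elliptic A \<longleftrightarrow>
     (\<exists>l L. 0 < l \<and> l \<le> L \<and> loewner_le (l *\<^sub>R mat 1) A \<and> loewner_le A (L *\<^sub>R mat 1))"

definition proportional :: "real^'n^'n \<Rightarrow> real^'n^'n \<Rightarrow> bool" where
  "proportional A B \<longleftrightarrow> (\<exists>c. A = c *\<^sub>R B \<or> B = c *\<^sub>R A)"

definition pos_part :: "('a \<Rightarrow> real) \<Rightarrow> 'a \<Rightarrow> real" where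
  "pos_part q = (\<lambda>z. max (q z) 0)"

definition neg_part :: "('a \<Rightarrow> real) \<Rightarrow> 'a \<Rightarrow> real" where
  "neg_part q = (\<lambda>z. max (- q z) 0)"

definition homogeneous :: "real \<Rightarrow> (real^'n \<Rightarrow> real) \<Rightarrow> bool" where
  "homogeneous \<sigma> q \<longleftrightarrow> (\<forall>t>0. \<forall>z. q (t *\<^sub>R z) = t powr \<sigma> * q z)"

text \<open>Local Hoelder continuity on the whole space, for exponents in the interval from 0 to 1.\<close>

definition holder_loc :: "real \<Rightarrow> (real^'n \<Rightarrow> real) \<Rightarrow> bool" where
  "holder_loc \<sigma> q \<longleftrightarrow>
     (\<forall>K. compact K \<longrightarrow> (\<exists>C. \<forall>z\<in>K. \<forall>w\<in>K. \<bar>q z - q w\<bar> \<le> C * norm (z - w) powr \<sigma>))"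

text \<open>This is a pointwise condition, for any positive exponent; in particular, for exponents
  above 1 no Taylor polynomial other than the constant one is subtracted.\<close>

definition holder_at_origin :: "real \<Rightarrow> (real^'n \<Rightarrow> real) \<Rightarrow> bool" where
  "holder_at_origin \<beta> q \<longleftrightarrow>
     (\<exists>C>0. \<exists>r>0. \<forall>z. norm z < r \<longrightarrow> \<bar>q z - q 0\<bar> \<le> C * norm z powr \<beta>)"

definition partial_deriv :: "'n::finite \<Rightarrow> (real^'n \<Rightarrow> real) \<Rightarrow> real^'n \<Rightarrow> real" where
  "partial_deriv i f z = frechet_derivative f (at z) (axis i 1)"

definition gradient :: "(real^'n \<Rightarrow> real) \<Rightarrow> real^'n \<Rightarrow> real^'n" where
  "gradient f z = (\<chi> i. partial_deriv i f z)"

text \<open>The class $C^k(S)$; it is meant for open sets \<open>S\<close>, because the derivatives are taken in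
  the whole space.\<close>

primrec Ck_on :: "nat \<Rightarrow> (real^'n) set \<Rightarrow> (real^'n \<Rightarrow> real) \<Rightarrow> bool" where
  "Ck_on 0 S f \<longleftrightarrow> continuous_on S f"
| "Ck_on (Suc k) S f \<longleftrightarrow>
     (\<forall>z\<in>S. f differentiable (at z)) \<and> (\<forall>i. Ck_on k S (partial_deriv i f))"

definition test_function :: "(real^'n \<Rightarrow> real) \<Rightarrow> bool" where
  "test_function \<phi> \<longleftrightarrow> (\<forall>k. Ck_on k UNIV \<phi>) \<and> compact (closure {z. \<phi> z \<noteq> 0})"

definition L1_loc :: "(real^'n \<Rightarrow> 'b::euclidean_space) \<Rightarrow> bool" where
  "L1_loc u \<longleftrightarrow> (\<forall>K. compact K \<longrightarrow> set_integrable lebesgue K u)"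

definition L2_loc :: "(real^'n \<Rightarrow> 'b::euclidean_space) \<Rightarrow> bool" where
  "L2_loc u \<longleftrightarrow> u \<in> borel_measurable lebesgue \<and>
     (\<forall>K. compact K \<longrightarrow> set_integrable lebesgue K (\<lambda>z. (norm (u z))\<^sup>2))"

text \<open>The local integrability requirements here and below make the Bochner integrals against
  test functions meaningful (they are 0 by convention for non-integrable functions).\<close>

definition has_weak_gradient :: "(real^'n \<Rightarrow> real) \<Rightarrow> (real^'n \<Rightarrow> real^'n) \<Rightarrow> bool" where
  "has_weak_gradient u g \<longleftrightarrow> L1_loc u \<and> L1_loc g \<and>
     (\<forall>\<phi>. test_function \<phi> \<longrightarrow>
        (\<forall>i. (LINT z|lebesgue. u z * partial_deriv i \<phi> z) = - (LINT z|lebesgue. g z $ i * \<phi> z)))"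

definition W12_loc :: "(real^'n \<Rightarrow> real) \<Rightarrow> bool" where
  "W12_loc u \<longleftrightarrow> L2_loc u \<and> (\<exists>g. L2_loc g \<and> has_weak_gradient u g)"

definition distributional_div_zero :: "(real^'n \<Rightarrow> real^'n) \<Rightarrow> bool" where
  "distributional_div_zero F \<longleftrightarrow> L1_loc F \<and>
     (\<forall>\<phi>. test_function \<phi> \<longrightarrow> (LINT z|lebesgue. F z \<bullet> gradient \<phi> z) = 0)"

text \<open>The equation $\mathrm{div}(A_+ \nabla q^+ - A_- \nabla q^-) = 0$. The gradients are weak
  gradients; these are unique up to null sets, so the choice of \<open>G\<close> and \<open>H\<close> is irrelevant.\<close>

definition two_phase_solution ::
    "real^'n^'n \<Rightarrow> real^'n^'n \<Rightarrow> (real^'n \<Rightarrow> real) \<Rightarrow> bool" where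
  "two_phase_solution Ap Am q \<longleftrightarrow>
     (\<exists>G H. has_weak_gradient (pos_part q) G \<and> has_weak_gradient (neg_part q) H \<and>
        distributional_div_zero (\<lambda>z. Ap *v G z - Am *v H z))"

text \<open>The identification of 4-space with the product of two planes, $z = (x, y)$.\<close>

definition x_part :: "real^4 \<Rightarrow> real^2" where
  "x_part z = vector [z $ 1, z $ 2]"

definition y_part :: "real^4 \<Rightarrow> real^2" where
  "y_part z = vector [z $ 3, z $ 4]"

end

theory Submission
  imports Defs
begin

text \<open>In the cone \<open>|x| > |y|\<close> the solution is \<open>q = P\<^sup>\<alpha> f(w)\<close> with \<open>\<alpha> = \<sigma> / 2\<close>,
  \<open>P = b |x|\<^sup>2 + a |y|\<^sup>2\<close> and \<open>w = a |y|\<^sup>2 / P\<close>; for \<open>A\<^sub>+ = diag(a, a, b, b)\<close> the equation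
  \<open>div (A\<^sub>+ \<nabla>q) = 0\<close> turns into Legendre's equation for \<open>f\<close>, whose regular solution
  decreases from 1 at \<open>w = 0\<close> to \<open>- \<infinity>\<close> at \<open>w = 1\<close>. Since \<open>w = a / (a + b)\<close> on the cone
  \<open>|x| = |y|\<close>, taking for \<open>a\<close> the zero of \<open>f\<close> and \<open>b = 1 - a\<close> makes \<open>q\<close> vanish there;
  \<open>a \<noteq> b\<close> because \<open>f(1/2) > 0\<close>. In the other cone \<open>q\<close> is minus the reflection of this function under \<open>(x, y) \<mapsto> (y, x)\<close>, with
  \<open>A\<^sub>- = diag(b, b, a, a)\<close>; the gradients match because of the antisymmetry.

  The weak equation needs no integration by parts over the cones. By Euler's identity for
  homogeneous functions the flux is the divergence of the antisymmetric matrix field with entries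
  \<open>h x\<^sub>i y\<^sub>j\<close>, where \<open>h = - a b P\<^bsup>\<alpha> - 1\<^esup> f'(w) / (\<alpha> + 1)\<close> extends continuously across the
  cone by symmetry, so everything reduces to \<open>\<partial>\<^sub>i \<partial>\<^sub>j \<phi> = \<partial>\<^sub>j \<partial>\<^sub>i \<phi>\<close> and to the fact that the weak
  derivatives of these entries are the classical ones off the cone. The latter follows from dominated
  convergence of difference quotients, which are bounded by \<open>C |z|\<^bsup>\<sigma> - 1\<^esup>\<close>.\<close>

section \<open>Test functions and local integrability\<close>

text \<open>Dyadic shells: where R / 2^(k+1) \<le> |z| < R / 2^k the integrand is at most its value
  at the inner radius, and the ball of radius R / 2^k has volume proportional to 2^(-dk). The
  resulting series is geometric with ratio 2^(-(d + e)), which is below 1 because e > -d.\<close>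

lemma set_integrable_norm_powr_ball:
  fixes R e :: real
  assumes R: "R > 0" and e: "e \<le> 0" "e > - real DIM('a)"
  shows "set_integrable lebesgue (ball 0 R) (\<lambda>z::'a::euclidean_space. norm z powr e)"
proof -
  define c where "c = unit_ball_vol (DIM('a)) * R ^ DIM('a)"
  \<comment> \<open>Each majorant lives on a whole ball instead of a shell; this only changes the
    constant in front of the geometric series.\<close>
  define u where "u k z = (R / 2 ^ Suc k) powr e * indicator (ball 0 (R / 2 ^ k)) z" for k and z :: 'a
  define \<rho> :: real where "\<rho> = 2 powr (- (real DIM('a) + e))"
  have u0: "u k z \<ge> 0" for k z by (simp add: u_def)
  have \<rho>: "0 < \<rho>" "\<rho> < 1"
    using e by (auto simp: \<rho>_def powr_less_one)
  have c0: "c \<ge> 0" using R by (simp add: c_def)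
  have int_u: "(\<integral>\<^sup>+z. ennreal (u k z) \<partial>lborel) = ennreal ((R / 2) powr e * c * \<rho> ^ k)" for k
  proof -
    have "(\<integral>\<^sup>+z. ennreal (u k z) \<partial>lborel)
        = (\<integral>\<^sup>+z. ennreal ((R / 2 ^ Suc k) powr e) * indicator (ball 0 (R / 2 ^ k)) (z::'a) \<partial>lborel)"
      by (intro nn_integral_cong) (auto simp: u_def indicator_def)
    also have "\<dots> = ennreal ((R / 2 ^ Suc k) powr e) * emeasure lborel (ball (0::'a) (R / 2 ^ k))"
      by (simp add: nn_integral_cmult_indicator)
    also have "\<dots> = ennreal ((R / 2 ^ Suc k) powr e * (unit_ball_vol (DIM('a)) * (R / 2 ^ k) ^ DIM('a)))"
      using R by (subst emeasure_ball) (auto simp: ennreal_mult)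
    also have "(R / 2 ^ Suc k) powr e * (unit_ball_vol (DIM('a)) * (R / 2 ^ k) ^ DIM('a))
        = (R / 2) powr e * c * \<rho> ^ k"
    proof -
      have "(R / 2 ^ Suc k) powr e = (R / 2) powr e * 2 powr (- (e * k))"
      proof -
        have "R / 2 ^ Suc k = (R / 2) * 2 powr (- real k)"
          by (simp add: powr_minus powr_realpow divide_simps)
        then show ?thesis using R by (simp only: powr_mult) (simp add: powr_powr mult.commute)
      qed
      moreover have "(R / 2 ^ k) ^ DIM('a) = R ^ DIM('a) * 2 powr (- (real DIM('a) * k))"
      proof -
        have "2 powr (real DIM('a) * k) = (2::real) ^ (DIM('a) * k)"
          by (metis of_nat_mult powr_realpow zero_less_numeral)
        also have "\<dots> = (2 ^ k) ^ DIM('a)" by (simp only: power_mult mult.commute[of "DIM('a)"])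
        finally show ?thesis by (simp add: power_mult_distrib power_inverse powr_minus divide_inverse)
      qed
      moreover have "\<rho> ^ k = 2 powr (- (e * k)) * 2 powr (- (real DIM('a) * k))"
      proof -
        have "\<rho> ^ k = 2 powr (- (real DIM('a) + e) * k)"
          using powr_realpow[OF \<rho>(1), of k] by (simp add: \<rho>_def powr_powr)
        also have "- (real DIM('a) + e) * k = - (e * k) + - (real DIM('a) * k)" by (simp add: algebra_simps)
        finally show ?thesis by (simp only: powr_add)
      qed
      ultimately show ?thesis
        by (simp only: c_def) (simp only: mult_ac)
    qed
    finally show ?thesis .
  qed
  have mu: "u k \<in> borel_measurable lborel" for k
    unfolding u_def[abs_def] by (intro borel_measurable_times borel_measurable_const borel_measurable_indicator) simp
  have mf: "(\<lambda>z::'a. indicator (ball 0 R) z *\<^sub>R norm z powr e) \<in> borel_measurable lborel"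
    by (intro borel_measurable_scaleR borel_measurable_indicator powr_real_measurable
        borel_measurable_norm borel_measurable_const) auto
  \<comment> \<open>A point z \<noteq> 0 of the ball belongs to the shell found from the least k
    with R / 2^k \<le> |z|, and k = 0 is excluded by |z| < R. At the origin the integrand is 0 by
    the convention \<open>0 powr e = 0\<close>.\<close>
  have bd: "ennreal (indicator (ball 0 R) z *\<^sub>R norm z powr e) \<le> (\<Sum>k. ennreal (u k z))" for z :: 'a
  proof (cases "z \<in> ball 0 R \<and> z \<noteq> 0")
    case True
    then have z: "0 < norm z" "norm z < R" by auto
    obtain m where m: "R / 2 ^ m \<le> norm z"
    proof -
      obtain m where "R / norm z < 2 ^ m"
        using real_arch_pow[of 2 "R / norm z"] by auto
      then show ?thesis using z that[of m] by (simp add: field_simps)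
    qed
    define k where "k = (LEAST m. R / 2 ^ m \<le> norm z)"
    have k: "R / 2 ^ k \<le> norm z" unfolding k_def by (rule LeastI[of _ m]) (rule m)
    then obtain j where j: "k = Suc j" using z by (cases k) auto
    have "\<not> R / 2 ^ j \<le> norm z"
      using not_less_Least[of j "\<lambda>m. R / 2 ^ m \<le> norm z"] j unfolding k_def by simp
    then have "norm z powr e \<le> u j z"
      using k j z e R by (auto simp: u_def intro!: powr_mono2')
    then have "ennreal (norm z powr e) \<le> ennreal (u j z)" by (simp add: ennreal_leI)
    also have "\<dots> \<le> (\<Sum>k. ennreal (u k z))"
      using sum_le_suminf[OF summableI, of "{j}" "\<lambda>k. ennreal (u k z)"] by simp
    finally show ?thesis using True by simp
  qed (auto simp: indicator_def)
  have "(\<integral>\<^sup>+z. ennreal (indicator (ball 0 R) z *\<^sub>R norm z powr e) \<partial>(lborel::'a measure))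
      \<le> (\<integral>\<^sup>+z. (\<Sum>k. ennreal (u k z)) \<partial>lborel)"
    by (rule nn_integral_mono) (rule bd)
  also have "\<dots> = (\<Sum>k. \<integral>\<^sup>+z. ennreal (u k z) \<partial>lborel)"
    by (rule nn_integral_suminf) (use mu in measurable)
  also have "\<dots> = (\<Sum>k. ennreal ((R / 2) powr e * c * \<rho> ^ k))"
    by (simp add: int_u)
  also have "\<dots> = ennreal (\<Sum>k. (R / 2) powr e * c * \<rho> ^ k)"
    using \<rho> c0 by (intro suminf_ennreal2) (auto intro!: summable_mult)
  also have "\<dots> < \<infinity>" by simp
  finally have "integrable lborel (\<lambda>z::'a. indicator (ball 0 R) z *\<^sub>R norm z powr e)"
    by (intro integrableI_nonneg mf) auto
  then show ?thesis
    unfolding set_integrable_def using mf by (subst integrable_completion)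
qed

section \<open>Symmetry of second derivatives, and basic properties of test functions\<close>

lemma partial_deriv_line:
  fixes f :: "real^'n \<Rightarrow> real"
  assumes "f differentiable (at (w + t *\<^sub>R axis k 1))"
  shows "((\<lambda>s. f (w + s *\<^sub>R axis k 1)) has_real_derivative partial_deriv k f (w + t *\<^sub>R axis k 1)) (at t)"
proof -
  let ?D = "frechet_derivative f (at (w + t *\<^sub>R axis k 1))"
  have "(f has_derivative ?D) (at (w + t *\<^sub>R axis k 1))"
    using assms frechet_derivative_works by blast
  then have "((\<lambda>s. f (w + s *\<^sub>R axis k 1)) has_derivative (\<lambda>s. ?D (s *\<^sub>R axis k 1))) (at t)"
    by (auto intro!: derivative_eq_intros has_derivative_compose[of "\<lambda>s. w + s *\<^sub>R axis k 1" _ t UNIV f])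
  moreover have "?D (s *\<^sub>R v) = ?D v * s" for s v
    using linear_scale[OF linear_frechet_derivative[OF assms], of s v] by (simp add: mult.commute)
  ultimately show ?thesis by (simp add: partial_deriv_def has_field_derivative_def)
qed

text \<open>The second difference over a square of side t is symmetric in the two directions.
  Divided by t^2 it equals either mixed partial at some point within distance 2t, so continuity of
  the second partials identifies both with one limit.\<close>

lemma mixed_partials_commute:
  fixes \<phi> :: "real^'n \<Rightarrow> real"
  assumes "Ck_on 2 UNIV \<phi>"
  shows "partial_deriv i (partial_deriv j \<phi>) z = partial_deriv j (partial_deriv i \<phi>) z"
proof -
  have d0: "\<forall>z. \<phi> differentiable (at z)" and d1: "\<forall>k. \<forall>z. partial_deriv k \<phi> differentiable (at z)"
    and c2: "continuous_on UNIV (partial_deriv k (partial_deriv l \<phi>))" for k l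
    using assms by (auto simp: numeral_2_eq_2)
  \<comment> \<open>The mean value theorem is applied in direction k to the increment over direction
    l, and then in direction l to \<open>partial_deriv k \<phi>\<close>.\<close>
  have key: "\<exists>w. norm (w - z) \<le> 2 * t \<and>
      \<phi> (z + t *\<^sub>R axis k 1 + t *\<^sub>R axis l 1) - \<phi> (z + t *\<^sub>R axis k 1) - \<phi> (z + t *\<^sub>R axis l 1) + \<phi> z
       = t * t * partial_deriv l (partial_deriv k \<phi>) w" if t: "t > 0" for t k l
  proof -
    define g where "g s = \<phi> (z + t *\<^sub>R axis l 1 + s *\<^sub>R axis k 1) - \<phi> (z + s *\<^sub>R axis k 1)" for s
    have "DERIV g s :> partial_deriv k \<phi> (z + t *\<^sub>R axis l 1 + s *\<^sub>R axis k 1)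
         - partial_deriv k \<phi> (z + s *\<^sub>R axis k 1)" for s
      unfolding g_def by (intro DERIV_diff partial_deriv_line) (use d0 in auto)
    then obtain s where s: "0 < s" "s < t" and gs: "g t - g 0 = (t - 0) *
        (partial_deriv k \<phi> (z + t *\<^sub>R axis l 1 + s *\<^sub>R axis k 1) - partial_deriv k \<phi> (z + s *\<^sub>R axis k 1))"
      using MVT2[OF t, of g "\<lambda>s. partial_deriv k \<phi> (z + t *\<^sub>R axis l 1 + s *\<^sub>R axis k 1)
         - partial_deriv k \<phi> (z + s *\<^sub>R axis k 1)"] by blast
    define h where "h u = partial_deriv k \<phi> (z + s *\<^sub>R axis k 1 + u *\<^sub>R axis l 1)" for u
    have "DERIV h u :> partial_deriv l (partial_deriv k \<phi>) (z + s *\<^sub>R axis k 1 + u *\<^sub>R axis l 1)" for u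
      unfolding h_def by (rule partial_deriv_line) (use d1 in auto)
    then obtain u where u: "0 < u" "u < t" and hu: "h t - h 0 = (t - 0) *
        partial_deriv l (partial_deriv k \<phi>) (z + s *\<^sub>R axis k 1 + u *\<^sub>R axis l 1)"
      using MVT2[OF t, of h "\<lambda>u. partial_deriv l (partial_deriv k \<phi>) (z + s *\<^sub>R axis k 1 + u *\<^sub>R axis l 1)"] by blast
    have "norm ((z + s *\<^sub>R axis k 1 + u *\<^sub>R axis l 1) - z) \<le> norm (s *\<^sub>R axis k (1::real)) + norm (u *\<^sub>R axis l (1::real))"
      using norm_triangle_ineq by (simp add: add.assoc del: norm_scaleR)
    also have "\<dots> \<le> 2 * t" using s u by simp
    finally have "norm ((z + s *\<^sub>R axis k 1 + u *\<^sub>R axis l 1) - z) \<le> 2 * t" .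
    moreover have "g t - g 0 = t * t * partial_deriv l (partial_deriv k \<phi>) (z + s *\<^sub>R axis k 1 + u *\<^sub>R axis l 1)"
    proof -
      have "g t - g 0 = t * (h t - h 0)"
        unfolding gs h_def by (simp only: diff_zero add_0_right scaleR_zero_left add.assoc add.commute[of "t *\<^sub>R axis l 1"])
      then show ?thesis unfolding hu by (simp only: diff_zero mult.assoc)
    qed
    moreover have "g t - g 0 = \<phi> (z + t *\<^sub>R axis k 1 + t *\<^sub>R axis l 1) - \<phi> (z + t *\<^sub>R axis k 1) - \<phi> (z + t *\<^sub>R axis l 1) + \<phi> z"
      unfolding g_def by (simp add: add.assoc add.commute[of "t *\<^sub>R axis l 1"])
    ultimately show ?thesis by metis
  qed
  define t where "t n = inverse (real (Suc n))" for n
  have t: "t n > 0" for n by (simp add: t_def)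
  have tl: "t \<longlonglongrightarrow> 0" unfolding t_def by (rule LIMSEQ_inverse_real_of_nat)
  have lim: "(\<lambda>n. (\<phi> (z + t n *\<^sub>R axis k 1 + t n *\<^sub>R axis l 1) - \<phi> (z + t n *\<^sub>R axis k 1)
        - \<phi> (z + t n *\<^sub>R axis l 1) + \<phi> z) / (t n * t n)) \<longlonglongrightarrow> partial_deriv l (partial_deriv k \<phi>) z" for k l
  proof -
    have "\<exists>w. \<forall>n. norm (w n - z) \<le> 2 * t n \<and> \<phi> (z + t n *\<^sub>R axis k 1 + t n *\<^sub>R axis l 1)
        - \<phi> (z + t n *\<^sub>R axis k 1) - \<phi> (z + t n *\<^sub>R axis l 1) + \<phi> z
       = t n * t n * partial_deriv l (partial_deriv k \<phi>) (w n)"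
      by (rule choice) (use key[OF t] in blast)
    then obtain w where w: "\<And>n. norm (w n - z) \<le> 2 * t n" "\<And>n. \<phi> (z + t n *\<^sub>R axis k 1 + t n *\<^sub>R axis l 1)
        - \<phi> (z + t n *\<^sub>R axis k 1) - \<phi> (z + t n *\<^sub>R axis l 1) + \<phi> z
       = t n * t n * partial_deriv l (partial_deriv k \<phi>) (w n)"
      by blast
    have "(\<lambda>n. norm (w n - z)) \<longlonglongrightarrow> 0"
      by (rule tendsto_sandwich[of "\<lambda>_. 0" _ _ "\<lambda>n. 2 * t n"]) (use w tl in \<open>auto intro!: tendsto_eq_intros\<close>)
    then have "w \<longlonglongrightarrow> z" by (simp add: LIM_zero_cancel tendsto_norm_zero_iff)
    then have "(\<lambda>n. partial_deriv l (partial_deriv k \<phi>) (w n)) \<longlonglongrightarrow> partial_deriv l (partial_deriv k \<phi>) z"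
      using c2 by (simp add: continuous_on_eq_continuous_at isCont_tendsto_compose)
    then show ?thesis unfolding w(2) using t by (simp add: less_imp_neq[symmetric])
  qed
  have "\<phi> (z + t n *\<^sub>R axis i 1 + t n *\<^sub>R axis j 1) - \<phi> (z + t n *\<^sub>R axis i 1) - \<phi> (z + t n *\<^sub>R axis j 1) + \<phi> z
      = \<phi> (z + t n *\<^sub>R axis j 1 + t n *\<^sub>R axis i 1) - \<phi> (z + t n *\<^sub>R axis j 1) - \<phi> (z + t n *\<^sub>R axis i 1) + \<phi> z" for n
    by (simp add: add.assoc add.commute[of "t n *\<^sub>R axis j 1"])
  then have "partial_deriv j (partial_deriv i \<phi>) z = partial_deriv i (partial_deriv j \<phi>) z"
    by (intro LIMSEQ_unique[OF lim[of i j]]) (simp only: lim)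
  then show ?thesis by simp
qed

lemma test_function_smooth:
  assumes "test_function \<phi>"
  shows "\<phi> differentiable (at z)" "continuous_on UNIV \<phi>" "continuous_on UNIV (partial_deriv i \<phi>)"
    "Ck_on 2 UNIV \<phi>"
proof -
  have C: "Ck_on k UNIV \<phi>" for k using assms unfolding test_function_def by blast
  have C1: "(\<forall>z. \<phi> differentiable (at z)) \<and> (\<forall>i. continuous_on UNIV (partial_deriv i \<phi>))"
    using C[of "Suc 0"] unfolding Ck_on.simps by blast
  show "\<phi> differentiable (at z)" using C1 by blast
  show "continuous_on UNIV \<phi>" using C[of 0] by (simp only: Ck_on.simps)
  show "continuous_on UNIV (partial_deriv i \<phi>)" using C1 by blast
  show "Ck_on 2 UNIV \<phi>" by (rule C)
qed

lemma partial_deriv_eq_0_outside_support: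
  fixes \<phi> :: "real^'n \<Rightarrow> real"
  assumes "z \<notin> closure {z. \<phi> z \<noteq> 0}"
  shows "partial_deriv i \<phi> z = 0"
proof -
  have "(\<phi> has_derivative (\<lambda>_. 0)) (at z)"
  proof (rule has_derivative_transform_within_open)
    show "((\<lambda>_. 0) has_derivative (\<lambda>_. 0)) (at z)" by simp
    show "open (- closure {z. \<phi> z \<noteq> 0})" by (rule open_Compl[OF closed_closure])
    show "z \<in> - closure {z. \<phi> z \<noteq> 0}" using assms by simp
    show "0 = \<phi> w" if "w \<in> - closure {z. \<phi> z \<noteq> 0}" for w
      using that closure_subset[of "{z. \<phi> z \<noteq> 0}"] by auto
  qed
  from frechet_derivative_at[OF this] have "frechet_derivative \<phi> (at z) = (\<lambda>_. 0)" by (rule sym)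
  then show ?thesis by (simp only: partial_deriv_def)
qed

text \<open>This lets a weak gradient be tested against a derivative of \<phi>, which is how second
  derivatives of \<phi> enter.\<close>

lemma test_function_partial_deriv:
  assumes "test_function \<phi>"
  shows "test_function (partial_deriv i \<phi>)"
proof -
  have "Ck_on k UNIV (partial_deriv i \<phi>)" for k
  proof -
    have "Ck_on (Suc k) UNIV \<phi>" using assms unfolding test_function_def by blast
    then show ?thesis by simp
  qed
  moreover have "closure {z. partial_deriv i \<phi> z \<noteq> 0} \<subseteq> closure {z. \<phi> z \<noteq> 0}"
    by (rule closure_minimal) (use partial_deriv_eq_0_outside_support in auto)
  ultimately show ?thesis
    using assms compact_Int_closed[of "closure {z. \<phi> z \<noteq> 0}" "closure {z. partial_deriv i \<phi> z \<noteq> 0}"]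
    by (auto simp: test_function_def Int_absorb1)
qed

lemma test_function_support:
  fixes \<phi> :: "real^'n \<Rightarrow> real"
  assumes "test_function \<phi>"
  obtains R where "R > 0" "\<And>z::real^'n. norm z \<ge> R \<Longrightarrow> \<phi> z = 0"
proof -
  have "bounded (closure {z. \<phi> z \<noteq> 0})"
    using assms by (auto simp: test_function_def compact_imp_bounded)
  then obtain R where R: "\<And>z. z \<in> closure {z. \<phi> z \<noteq> 0} \<Longrightarrow> norm z \<le> R"
    unfolding bounded_iff by blast
  show ?thesis
  proof
    show "\<bar>R\<bar> + 1 > 0" by simp
    fix z :: "real^'n" assume "norm z \<ge> \<bar>R\<bar> + 1"
    then show "\<phi> z = 0" using R[of z] closure_subset[of "{z. \<phi> z \<noteq> 0}"] by force
  qed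
qed

lemma test_function_bounded:
  fixes \<phi> :: "real^'n \<Rightarrow> real"
  assumes "test_function \<phi>"
  obtains M where "M \<ge> 0" "\<And>z. \<bar>\<phi> z\<bar> \<le> M"
proof -
  obtain R where R: "R > 0" "\<And>z. norm z \<ge> R \<Longrightarrow> \<phi> z = 0"
    using test_function_support[OF assms] by blast
  have "compact (\<phi> ` cball 0 R)"
    using test_function_smooth(2)[OF assms]
    by (intro compact_continuous_image) (auto intro: continuous_on_subset)
  then obtain M where "\<forall>y\<in>\<phi> ` cball 0 R. norm y \<le> M"
    using compact_imp_bounded bounded_iff by metis
  then have M: "\<And>z. norm z \<le> R \<Longrightarrow> \<bar>\<phi> z\<bar> \<le> M"
    by simp
  have "M \<ge> 0" using M[of 0] R by simp
  then show ?thesis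
    using M R(2) by (intro that[of M]) (metis abs_zero linear)+
qed

section \<open>Integrability on compact sets and translation of integrals\<close>

lemma continuous_borel_lebesgue:
  fixes f :: "real^'n \<Rightarrow> real"
  assumes "continuous_on UNIV f"
  shows "f \<in> borel_measurable borel" "f \<in> borel_measurable lborel" "f \<in> borel_measurable lebesgue"
  using borel_measurable_continuous_onI[OF assms] by (auto intro: measurable_completion)

lemma continuous_set_integrable_lebesgue:
  fixes f :: "real^'n \<Rightarrow> real"
  assumes "continuous_on UNIV f" "compact K"
  shows "set_integrable lebesgue K f"
proof -
  have K: "K \<in> sets borel" using assms(2) by (simp add: borel_compact)
  have "integrable lborel (\<lambda>x. indicator K x *\<^sub>R f x)"
    using assms by (intro borel_integrable_compact) (auto intro: continuous_on_subset)
  then show ?thesis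
    unfolding set_integrable_def using K continuous_borel_lebesgue(2)[OF assms(1)]
    by (subst integrable_completion) auto
qed

lemma continuous_compact_support_integrable:
  fixes f :: "real^'n \<Rightarrow> real"
  assumes "continuous_on UNIV f" "\<And>z. norm z \<ge> R \<Longrightarrow> f z = 0"
  shows "integrable lebesgue f"
proof -
  have "f = (\<lambda>z. indicator (cball 0 R) z *\<^sub>R f z)"
    using assms(2) by (auto simp: indicator_def fun_eq_iff)
  then show ?thesis
    using continuous_set_integrable_lebesgue[OF assms(1), of "cball 0 R"] by (simp add: set_integrable_def)
qed

text \<open>Translation invariance is the source of discrete integration by parts: it moves a
  difference quotient from one factor of a product to the other.\<close>

lemma lebesgue_integral_translate:
  fixes f :: "real^'n \<Rightarrow> real"
  assumes "continuous_on UNIV f"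
  shows "(LINT z|lebesgue. f (z + c)) = (LINT z|lebesgue. f z)"
proof -
  have f: "f \<in> borel_measurable borel" using assms by (rule continuous_borel_lebesgue)
  have "(LINT z|lebesgue. f (z + c)) = (LINT z|lborel. f (c + z))"
    using f by (subst integral_completion) (auto simp: add.commute)
  also have "\<dots> = (LINT z|distr lborel borel ((+) c). f z)"
    using f by (subst integral_distr) auto
  also have "\<dots> = (LINT z|lebesgue. f z)"
    using f by (simp add: lborel_distr_plus integral_completion)
  finally show ?thesis .
qed

lemma set_integrable_norm_powr_bound:
  fixes f :: "real^'n \<Rightarrow> 'b::euclidean_space"
  assumes "f \<in> borel_measurable lebesgue" "AE z in lebesgue. norm (f z) \<le> M * norm z powr e"
    "e \<le> 0" "e > - real CARD('n)" "compact K"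
  shows "set_integrable lebesgue K f"
proof -
  obtain R where R: "R > 0" "K \<subseteq> ball 0 R"
    using bounded_subset_ballD[OF compact_imp_bounded[OF assms(5)], of 0] by auto
  have "set_integrable lebesgue (ball 0 R) (\<lambda>z::real^'n. M * norm z powr e)"
    using set_integrable_norm_powr_ball[of R e, where 'a="real^'n"] R assms by auto
  then have "set_integrable lebesgue (ball 0 R) f"
  proof (rule set_integrable_bound)
    show "set_borel_measurable lebesgue (ball 0 R) f"
      unfolding set_borel_measurable_def using assms(1) by (intro borel_measurable_scaleR borel_measurable_indicator) auto
    show "AE x in lebesgue. x \<in> ball 0 R \<longrightarrow> norm (f x) \<le> norm (M * norm x powr e)"
      using assms(2) by eventually_elim auto
  qed
  then show ?thesis
    by (rule set_integrable_subset) (use R assms(5) in \<open>auto simp: borel_compact\<close>)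
qed

lemma test_function_integrable_mult:
  fixes g :: "real^'n \<Rightarrow> real^'n"
  assumes g: "L1_loc g" and \<phi>: "test_function \<phi>"
  shows "integrable lebesgue (\<lambda>z. g z $ i * \<phi> z)"
proof -
  obtain R where R: "R > 0" "\<And>z. norm z \<ge> R \<Longrightarrow> \<phi> z = 0" using test_function_support[OF \<phi>] by blast
  obtain M where M: "M \<ge> 0" "\<And>z. \<bar>\<phi> z\<bar> \<le> M" using test_function_bounded[OF \<phi>] by blast
  have "set_integrable lebesgue (cball 0 R) g" using g by (simp add: L1_loc_def)
  then have "integrable lebesgue (\<lambda>z. (indicator (cball 0 R) z *\<^sub>R g z) \<bullet> axis i 1)"
    unfolding set_integrable_def by (rule integrable_inner_left)
  then have i: "integrable lebesgue (\<lambda>z. indicator (cball 0 R) z * g z $ i)"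
    by (simp add: inner_axis)
  have "integrable lebesgue (\<lambda>z. (indicator (cball 0 R) z * g z $ i) * \<phi> z)"
  proof (rule Bochner_Integration.integrable_bound)
    show "integrable lebesgue (\<lambda>z. M * (indicator (cball 0 R) z * g z $ i))"
      using i by (rule integrable_mult_right)
    show "(\<lambda>z. (indicator (cball 0 R) z * g z $ i) * \<phi> z) \<in> borel_measurable lebesgue"
      by (rule borel_measurable_times[OF borel_measurable_integrable[OF i]
            continuous_borel_lebesgue(3)[OF test_function_smooth(2)[OF \<phi>]]])
    show "AE z in lebesgue. norm ((indicator (cball 0 R) z * g z $ i) * \<phi> z)
        \<le> norm (M * (indicator (cball 0 R) z * g z $ i))"
      unfolding norm_mult using M
      by (intro AE_I2) (simp add: mult.commute mult_right_mono)
  qed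
  moreover have "(indicator (cball 0 R) z * g z $ i) * \<phi> z = g z $ i * \<phi> z" for z
    using R(2)[of z] by (cases "norm z \<le> R") auto
  ultimately show ?thesis by simp
qed

lemma L1_loc_matrix_diff:
  fixes G H :: "real^'n \<Rightarrow> real^'n" and A B :: "real^'n^'n"
  assumes "L1_loc G" "L1_loc H"
  shows "L1_loc (\<lambda>z. A *v G z - B *v H z)"
  unfolding L1_loc_def
proof (intro allI impI)
  fix K :: "(real^'n) set" assume K: "compact K"
  have "integrable lebesgue (\<lambda>z. A *v (indicator K z *\<^sub>R G z) - B *v (indicator K z *\<^sub>R H z))"
    using assms K unfolding L1_loc_def set_integrable_def
    by (intro Bochner_Integration.integrable_diff integrable_bounded_linear[OF matrix_vector_mul_bounded_linear]) auto
  then show "set_integrable lebesgue K (\<lambda>z. A *v G z - B *v H z)"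
    unfolding set_integrable_def by (simp add: matrix_vector_mult_scaleR scaleR_diff_right)
qed

section \<open>Weak gradients of homogeneous Lipschitz functions\<close>

text \<open>The mean value theorem bounds the difference quotients of a test function uniformly in
  the step, which supplies a dominating function below.\<close>

lemma test_function_difference_bound:
  fixes \<phi> :: "real^'n \<Rightarrow> real"
  assumes "test_function \<phi>" "\<And>z. \<bar>partial_deriv i \<phi> z\<bar> \<le> M" "t > 0"
  shows "\<bar>\<phi> (z + t *\<^sub>R axis i 1) - \<phi> z\<bar> \<le> M * t"
proof -
  have "DERIV (\<lambda>s. \<phi> (z + s *\<^sub>R axis i 1)) s :> partial_deriv i \<phi> (z + s *\<^sub>R axis i 1)" for s
    by (rule partial_deriv_line[OF test_function_smooth(1)[OF assms(1)]])
  then obtain s where "\<phi> (z + t *\<^sub>R axis i 1) - \<phi> (z + 0 *\<^sub>R axis i 1)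
      = (t - 0) * partial_deriv i \<phi> (z + s *\<^sub>R axis i 1)"
    using MVT2[OF assms(3), of "\<lambda>s. \<phi> (z + s *\<^sub>R axis i 1)" "\<lambda>s. partial_deriv i \<phi> (z + s *\<^sub>R axis i 1)"]
    by blast
  then show ?thesis
    using assms(2)[of "z + s *\<^sub>R axis i 1"] assms(3) by (simp add: abs_mult mult.commute mult_left_mono)
qed

text \<open>The pointwise estimate satisfied by positively homogeneous functions of degree \<open>\<sigma>\<close>
  that are Lipschitz away from the origin.\<close>

definition homogeneous_lipschitz :: "real \<Rightarrow> real \<Rightarrow> (real^'n \<Rightarrow> real) \<Rightarrow> bool" where
  "homogeneous_lipschitz \<sigma> C u \<longleftrightarrow> C \<ge> 0 \<and>
     (\<forall>z w. z \<noteq> 0 \<longrightarrow> \<bar>u z - u w\<bar> \<le> C * norm (z - w) * norm z powr (\<sigma> - 1))"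

text \<open>The weight in the estimate sits at the first point only. Away from the origin the
  estimate is Lipschitz continuity at z; at the origin the moving point w takes the first place,
  which gives the bound C |w|^\<sigma>.\<close>

lemma homogeneous_lipschitz_continuous:
  fixes u :: "real^'n \<Rightarrow> real" and \<sigma> C :: real
  assumes u: "homogeneous_lipschitz \<sigma> C u" and \<sigma>: "0 < \<sigma>"
  shows "continuous_on UNIV u"
proof -
  have L: "\<bar>u z - u w\<bar> \<le> C * norm (z - w) * norm z powr (\<sigma> - 1)" if "z \<noteq> 0" for z w
    using u that by (simp add: homogeneous_lipschitz_def)
  have "(u \<longlongrightarrow> u z) (at z)" for z
  proof (cases "z = 0")
    case True
    have "((\<lambda>w. u w - u 0) \<longlongrightarrow> 0) (at 0)"
    proof (rule Lim_null_comparison)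
      have "((\<lambda>w::real^'n. norm w powr \<sigma>) \<longlongrightarrow> 0) (at 0)"
      proof -
        have "((\<lambda>w::real^'n. norm w powr \<sigma>) \<longlongrightarrow> 0 powr \<sigma>) (at 0)"
          using \<sigma> by (intro tendsto_powr2 tendsto_norm_zero tendsto_const tendsto_ident_at) auto
        then show ?thesis by simp
      qed
      then show "((\<lambda>w::real^'n. C * norm w powr \<sigma>) \<longlongrightarrow> 0) (at 0)"
        by (rule tendsto_mult_right_zero)
      show "\<forall>\<^sub>F w in at 0. norm (u w - u 0) \<le> C * norm w powr \<sigma>"
      proof (rule eventually_mono[OF eventually_neq_at_within[of 0]])
        fix w :: "real^'n" assume "w \<noteq> 0"
        then show "norm (u w - u 0) \<le> C * norm w powr \<sigma>"
          using L[of w 0] by (simp add: powr_diff)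
      qed
    qed
    then show ?thesis using True LIM_zero_cancel by blast
  next
    case False
    have "((\<lambda>w. u w - u z) \<longlongrightarrow> 0) (at z)"
    proof (rule Lim_null_comparison)
      show "\<forall>\<^sub>F w in at z. norm (u w - u z) \<le> C * norm (z - w) * norm z powr (\<sigma> - 1)"
        using L[OF False] by (auto simp: abs_minus_commute intro: always_eventually)
      have "((\<lambda>w. C * norm (z - w) * norm z powr (\<sigma> - 1)) \<longlongrightarrow> C * norm (z - z) * norm z powr (\<sigma> - 1)) (at z)"
        by (intro tendsto_intros)
      then show "((\<lambda>w. C * norm (z - w) * norm z powr (\<sigma> - 1)) \<longlongrightarrow> 0) (at z)" by simp
    qed
    then show ?thesis using LIM_zero_cancel by blast
  qed
  then show ?thesis by (simp add: continuous_on_def)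
qed

lemma filterlim_inverse_Suc_at_0:
  "filterlim (\<lambda>n. inverse (real (Suc n))) (at 0) sequentially"
  unfolding filterlim_at using LIMSEQ_inverse_real_of_nat
  by (intro conjI) (auto intro!: always_eventually simp del: of_nat_Suc)

text \<open>The gradient inherits measurability and the bound by |z|^(\<sigma> - 1) as an almost
  everywhere limit of continuous difference quotients.\<close>

lemma homogeneous_lipschitz_gradient:
  fixes u :: "real^'n \<Rightarrow> real" and \<sigma> C :: real
  assumes u: "homogeneous_lipschitz \<sigma> C u" and \<sigma>: "0 < \<sigma>"
    and der: "AE z in lebesgue. (u has_derivative (\<lambda>v. g z \<bullet> v)) (at z)"
  defines "dq i n \<equiv> \<lambda>z. (u (z + inverse (real (Suc n)) *\<^sub>R axis i 1) - u z) / inverse (real (Suc n))"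
  shows "AE z in lebesgue. \<forall>i. (\<lambda>n. dq i n z) \<longlonglongrightarrow> g z $ i"
    and "z \<noteq> 0 \<Longrightarrow> \<bar>dq i n z\<bar> \<le> C * norm z powr (\<sigma> - 1)"
    and "continuous_on UNIV (dq i n)"
    and "g \<in> borel_measurable lebesgue"
    and "AE z in lebesgue. norm (g z) \<le> (real CARD('n) * C) * norm z powr (\<sigma> - 1)"
proof -
  note cu = homogeneous_lipschitz_continuous[OF u \<sigma>]
  have nz: "AE z in lebesgue. z \<noteq> (0::real^'n)"
    by (rule AE_I'[of "{0}"]) (auto simp: negligible_iff_null_sets[symmetric])
  show lim: "AE z in lebesgue. \<forall>i. (\<lambda>n. dq i n z) \<longlonglongrightarrow> g z $ i"
    using der
  proof eventually_elim
    fix z assume D: "(u has_derivative (\<lambda>v. g z \<bullet> v)) (at z)"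
    show "\<forall>i. (\<lambda>n. dq i n z) \<longlonglongrightarrow> g z $ i"
    proof
      fix i
      have *: "frechet_derivative u (at z) = (\<lambda>v. g z \<bullet> v)"
        using frechet_derivative_at[OF D] by simp
      have "DERIV (\<lambda>s. u (z + s *\<^sub>R axis i 1)) 0 :> partial_deriv i u (z + 0 *\<^sub>R axis i 1)"
        by (rule partial_deriv_line) (use D differentiable_def in auto)
      then have "DERIV (\<lambda>s. u (z + s *\<^sub>R axis i 1)) 0 :> g z $ i"
        by (simp add: partial_deriv_def * inner_axis)
      then have "((\<lambda>h. (u (z + h *\<^sub>R axis i 1) - u z) / h) \<longlongrightarrow> g z $ i) (at 0)"
        by (simp add: DERIV_def)
      then show "(\<lambda>n. dq i n z) \<longlonglongrightarrow> g z $ i"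
        unfolding dq_def using filterlim_inverse_Suc_at_0 by (rule filterlim_compose)
    qed
  qed
  \<comment> \<open>The weight is taken at z and not at the shifted point, so the bound does not
    depend on the step.\<close>
  show bd: "\<bar>dq i n z\<bar> \<le> C * norm z powr (\<sigma> - 1)" if "z \<noteq> 0" for i n z
  proof -
    let ?t = "inverse (real (Suc n))"
    have "\<bar>u z - u (z + ?t *\<^sub>R axis i 1)\<bar> \<le> C * norm (z - (z + ?t *\<^sub>R axis i 1)) * norm z powr (\<sigma> - 1)"
      using u that unfolding homogeneous_lipschitz_def by blast
    then have "\<bar>u (z + ?t *\<^sub>R axis i 1) - u z\<bar> \<le> C * \<bar>?t\<bar> * norm z powr (\<sigma> - 1)"
      by (simp only: abs_minus_commute[of "u z"] norm_minus_cancel norm_scaleR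
          norm_axis_1 mult_1_right norm_minus_commute[of z] add_diff_cancel_left')
    moreover have "?t > 0" by simp
    ultimately have "\<bar>u (z + ?t *\<^sub>R axis i 1) - u z\<bar> / ?t \<le> C * norm z powr (\<sigma> - 1)"
      using pos_divide_le_eq[of ?t] by (simp only: abs_of_pos mult_ac)
    then show ?thesis
      using \<open>?t > 0\<close> by (simp only: dq_def abs_divide abs_of_pos)
  qed
  show cdq: "continuous_on UNIV (dq i n)" for i n
    unfolding dq_def by (intro continuous_intros continuous_on_compose2[OF cu]) auto
  have "(\<lambda>z. g z $ i) \<in> borel_measurable lebesgue" for i
  proof (rule borel_measurable_AE)
    show "(\<lambda>z. lim (\<lambda>n. dq i n z)) \<in> borel_measurable lebesgue"
      by (intro borel_measurable_lim_metric continuous_borel_lebesgue(3) cdq)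
    show "AE z in lebesgue. lim (\<lambda>n. dq i n z) = g z $ i"
      using lim by eventually_elim (auto intro: limI)
  qed
  then show "g \<in> borel_measurable lebesgue"
    by (subst borel_measurable_euclidean_space) (auto simp: Basis_vec_def inner_axis)
  show "AE z in lebesgue. norm (g z) \<le> (real CARD('n) * C) * norm z powr (\<sigma> - 1)"
    using lim nz
  proof eventually_elim
    fix z assume *: "\<forall>i. (\<lambda>n. dq i n z) \<longlonglongrightarrow> g z $ i" and "z \<noteq> 0"
    then have "\<bar>g z $ i\<bar> \<le> C * norm z powr (\<sigma> - 1)" for i
      using bd by (intro LIMSEQ_le_const2[OF tendsto_rabs[OF *[rule_format]]]) blast
    \<comment> \<open>The Euclidean norm is at most the sum of the absolute components, hence the
      factor \<open>CARD('n)\<close>.\<close>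
    then have "(\<Sum>i\<in>UNIV. \<bar>g z $ i\<bar>) \<le> (\<Sum>i\<in>(UNIV::'n set). C * norm z powr (\<sigma> - 1))"
      by (rule sum_mono)
    then show "norm (g z) \<le> (real CARD('n) * C) * norm z powr (\<sigma> - 1)"
      using norm_le_l1_cart[of "g z"] by simp
  qed
qed

text \<open>Integration by parts is exact for difference quotients, and dominated convergence
  removes the step on both sides. The dimension hypothesis makes |z|^(2\<sigma> - 2), the bound for
  the squared gradient, integrable at the origin.\<close>

lemma homogeneous_lipschitz_weak_gradient:
  fixes u :: "real^'n \<Rightarrow> real" and \<sigma> C :: real
  assumes u: "homogeneous_lipschitz \<sigma> C u" and \<sigma>: "0 < \<sigma>" "\<sigma> < 1" and n: "2 - 2 * \<sigma> < CARD('n)"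
    and der: "AE z in lebesgue. (u has_derivative (\<lambda>v. g z \<bullet> v)) (at z)"
  shows "has_weak_gradient u g" "L2_loc u" "L2_loc g"
proof -
  define dq where "dq i n z = (u (z + inverse (real (Suc n)) *\<^sub>R axis i 1) - u z) / inverse (real (Suc n))" for i n z
  note G = homogeneous_lipschitz_gradient[OF u \<sigma>(1) der, folded dq_def]
  note cu = homogeneous_lipschitz_continuous[OF u \<sigma>(1)]
  have nz: "AE z in lebesgue. z \<noteq> (0::real^'n)"
    by (rule AE_I'[of "{0}"]) (auto simp: negligible_iff_null_sets[symmetric])
  have e1: "\<sigma> - 1 > - real CARD('n)" 
  proof -
    have "CARD('n) \<ge> 1" by (simp add: Suc_leI)
    then have "real CARD('n) \<ge> 1" by (metis of_nat_1 of_nat_le_iff)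
    then show ?thesis using \<sigma> by linarith
  qed
  show "L2_loc g"
    unfolding L2_loc_def
  proof (intro conjI allI impI G(4))
    fix K :: "(real^'n) set" assume "compact K"
    show "set_integrable lebesgue K (\<lambda>z. (norm (g z))\<^sup>2)"
    proof (rule set_integrable_norm_powr_bound)
      show "(\<lambda>z. (norm (g z))\<^sup>2) \<in> borel_measurable lebesgue" using G(4) by measurable
      show "AE z in lebesgue. norm ((norm (g z))\<^sup>2) \<le> (real CARD('n) * C)\<^sup>2 * norm z powr (2 * \<sigma> - 2)"
        using G(5)
      proof eventually_elim
        fix z assume "norm (g z) \<le> (real CARD('n) * C) * norm z powr (\<sigma> - 1)"
        then have "(norm (g z))\<^sup>2 \<le> ((real CARD('n) * C) * norm z powr (\<sigma> - 1))\<^sup>2"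
          by (intro power_mono) auto
        also have "\<dots> = (real CARD('n) * C)\<^sup>2 * norm z powr (2 * \<sigma> - 2)"
          by (simp add: power_mult_distrib power2_eq_square powr_add[symmetric])
        finally show "norm ((norm (g z))\<^sup>2) \<le> (real CARD('n) * C)\<^sup>2 * norm z powr (2 * \<sigma> - 2)" by simp
      qed
    qed (use \<sigma> n \<open>compact K\<close> in auto)
  qed
  show "L2_loc u"
    unfolding L2_loc_def
    by (intro conjI allI impI continuous_borel_lebesgue(3)[OF cu] continuous_set_integrable_lebesgue
        continuous_intros cu)
  show "has_weak_gradient u g"
    unfolding has_weak_gradient_def
  proof (intro conjI allI impI)
    show "L1_loc u"
      unfolding L1_loc_def by (intro allI impI continuous_set_integrable_lebesgue cu)
    show "L1_loc g"
      unfolding L1_loc_def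
      by (intro allI impI set_integrable_norm_powr_bound[OF G(4) G(5) _ e1]) (use \<sigma> in auto)
    fix \<phi> :: "real^'n \<Rightarrow> real" and i assume \<phi>: "test_function \<phi>"
    note c\<phi> = test_function_smooth(2)[OF \<phi>]
    obtain R where R: "R > 0" "\<And>z. norm z \<ge> R \<Longrightarrow> \<phi> z = 0" using test_function_support[OF \<phi>] by blast
    obtain M0 where M0: "M0 \<ge> 0" "\<And>z. \<bar>\<phi> z\<bar> \<le> M0" using test_function_bounded[OF \<phi>] by blast
    obtain M1 where M1: "M1 \<ge> 0" "\<And>z. \<bar>partial_deriv i \<phi> z\<bar> \<le> M1"
      using test_function_bounded[OF test_function_partial_deriv[OF \<phi>]] by blast
    define T where "T n = inverse (real (Suc n))" for n
    have T: "0 < T n" "T n \<le> 1" for n by (auto simp: T_def divide_simps)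
    have Tlim: "filterlim T (at 0) sequentially"
      unfolding T_def[abs_def] by (rule filterlim_inverse_Suc_at_0)
    define e where "e = (axis i 1 :: real^'n)"
    have ne: "norm e = 1" by (simp add: e_def)
    define S1 where "S1 n z = u z * ((\<phi> z - \<phi> (z - T n *\<^sub>R e)) / T n)" for n z
    define S2 where "S2 n z = dq i n z * \<phi> z" for n z
    \<comment> \<open>Since the steps are at most 1, all shifted test functions vanish outside one
      common ball of radius R + 1.\<close>
    have shift0: "\<phi> (z - T n *\<^sub>R e) = 0" if "norm z \<ge> R + 1" for z n
    proof (rule R(2))
      have "norm z \<le> norm (z - T n *\<^sub>R e) + norm (T n *\<^sub>R e)"
        using norm_triangle_ineq[of "z - T n *\<^sub>R e" "T n *\<^sub>R e"] by simp
      then show "R \<le> norm (z - T n *\<^sub>R e)" using that T[of n] ne by simp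
    qed
    have c1: "continuous_on UNIV (\<lambda>z. \<phi> (z - T n *\<^sub>R e))" for n
      by (intro continuous_on_compose2[OF c\<phi>] continuous_intros) auto
    have c2: "continuous_on UNIV (\<lambda>z. u (z + T n *\<^sub>R e))" for n
      by (intro continuous_on_compose2[OF cu] continuous_intros) auto
    \<comment> \<open>Discrete integration by parts: the forward quotient of u against \<phi>
      becomes minus u against the backward quotient of \<phi>.\<close>
    have S12: "integral\<^sup>L lebesgue (S2 n) = - integral\<^sup>L lebesgue (S1 n)" for n
    proof -
      have i1: "integrable lebesgue (\<lambda>z. u (z + T n *\<^sub>R e) * \<phi> z)"
        by (rule continuous_compact_support_integrable[of _ R]) (use R in \<open>auto intro!: continuous_intros c2 c\<phi>\<close>)
      have i2: "integrable lebesgue (\<lambda>z. u z * \<phi> z)"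
        by (rule continuous_compact_support_integrable[of _ R]) (use R in \<open>auto intro!: continuous_intros cu c\<phi>\<close>)
      have i3: "integrable lebesgue (\<lambda>z. u z * \<phi> (z - T n *\<^sub>R e))"
        by (rule continuous_compact_support_integrable[of _ "R + 1"])
          (use shift0 in \<open>auto intro!: continuous_intros cu c1\<close>)
      have tr: "(LINT z|lebesgue. u (z + T n *\<^sub>R e) * \<phi> z) = (LINT z|lebesgue. u z * \<phi> (z - T n *\<^sub>R e))"
      proof -
        have "continuous_on UNIV (\<lambda>z. u z * \<phi> (z - T n *\<^sub>R e))"
          by (intro continuous_intros cu c1)
        from lebesgue_integral_translate[OF this, of "T n *\<^sub>R e"] show ?thesis by simp
      qed
      have "integral\<^sup>L lebesgue (S2 n) = (LINT z|lebesgue. (u (z + T n *\<^sub>R e) * \<phi> z - u z * \<phi> z) / T n)"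
        by (rule Bochner_Integration.integral_cong) (auto simp: S2_def dq_def T_def e_def algebra_simps)
      also have "\<dots> = ((LINT z|lebesgue. u (z + T n *\<^sub>R e) * \<phi> z) - (LINT z|lebesgue. u z * \<phi> z)) / T n"
        using i1 i2 by simp
      also have "\<dots> = - (((LINT z|lebesgue. u z * \<phi> z) - (LINT z|lebesgue. u z * \<phi> (z - T n *\<^sub>R e))) / T n)"
        unfolding tr using T[of n] by (simp add: field_simps)
      also have "\<dots> = - (LINT z|lebesgue. (u z * \<phi> z - u z * \<phi> (z - T n *\<^sub>R e)) / T n)"
        using i2 i3 by simp
      also have "(LINT z|lebesgue. (u z * \<phi> z - u z * \<phi> (z - T n *\<^sub>R e)) / T n) = integral\<^sup>L lebesgue (S1 n)"
        by (rule Bochner_Integration.integral_cong) (auto simp: S1_def algebra_simps)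
      finally show ?thesis .
    qed
    have lim1: "(\<lambda>n. integral\<^sup>L lebesgue (S1 n)) \<longlonglongrightarrow> (LINT z|lebesgue. u z * partial_deriv i \<phi> z)"
    proof (rule integral_dominated_convergence)
      show "(\<lambda>z. u z * partial_deriv i \<phi> z) \<in> borel_measurable lebesgue"
        by (intro continuous_borel_lebesgue(3) continuous_intros cu test_function_smooth(3)[OF \<phi>])
      show "S1 n \<in> borel_measurable lebesgue" for n
        unfolding S1_def using T[of n] by (intro continuous_borel_lebesgue(3) continuous_intros cu c\<phi> c1) auto
      show "integrable lebesgue (\<lambda>z. indicator (cball 0 (R + 1)) z *\<^sub>R (M1 * \<bar>u z\<bar>))"
      proof -
        have "continuous_on UNIV (\<lambda>z. M1 * \<bar>u z\<bar>)" by (intro continuous_intros cu)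
        then show ?thesis
          using continuous_set_integrable_lebesgue[of _ "cball 0 (R + 1)"] by (simp add: set_integrable_def)
      qed
      show "AE z in lebesgue. (\<lambda>n. S1 n z) \<longlonglongrightarrow> u z * partial_deriv i \<phi> z"
      proof (rule AE_I2)
        fix z
        have "DERIV (\<lambda>s. \<phi> (z + s *\<^sub>R axis i 1)) 0 :> partial_deriv i \<phi> (z + 0 *\<^sub>R axis i 1)"
          by (rule partial_deriv_line) (rule test_function_smooth(1)[OF \<phi>])
        then have "((\<lambda>h. (\<phi> (z + h *\<^sub>R e) - \<phi> z) / h) \<longlongrightarrow> partial_deriv i \<phi> z) (at 0)"
          by (simp add: DERIV_def e_def)
        \<comment> \<open>The backward quotient is the forward quotient with a negative
          step.\<close>
        moreover have "filterlim (\<lambda>n. - T n) (at 0) sequentially"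
          using Tlim tendsto_minus[of T 0 sequentially] by (auto simp: filterlim_at)
        ultimately have "(\<lambda>n. (\<phi> (z + (- T n) *\<^sub>R e) - \<phi> z) / (- T n)) \<longlonglongrightarrow> partial_deriv i \<phi> z"
          by (rule filterlim_compose)
        moreover have "(\<phi> (z + (- T n) *\<^sub>R e) - \<phi> z) / (- T n) = (\<phi> z - \<phi> (z - T n *\<^sub>R e)) / T n" for n
          using T[of n] by (simp add: field_simps)
        ultimately have "(\<lambda>n. (\<phi> z - \<phi> (z - T n *\<^sub>R e)) / T n) \<longlonglongrightarrow> partial_deriv i \<phi> z"
          by simp
        then show "(\<lambda>n. S1 n z) \<longlonglongrightarrow> u z * partial_deriv i \<phi> z"
          unfolding S1_def by (rule tendsto_mult_left)
      qed
      show "AE z in lebesgue. norm (S1 n z) \<le> indicator (cball 0 (R + 1)) z *\<^sub>R (M1 * \<bar>u z\<bar>)" for n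
      proof (rule AE_I2)
        fix z
        show "norm (S1 n z) \<le> indicator (cball 0 (R + 1)) z *\<^sub>R (M1 * \<bar>u z\<bar>)"
        proof (cases "norm z \<le> R + 1")
          case True
          have "\<bar>\<phi> z - \<phi> (z - T n *\<^sub>R e)\<bar> \<le> M1 * T n"
            using test_function_difference_bound[OF \<phi> M1(2) T(1), of "z - T n *\<^sub>R e" n] by (simp add: e_def)
          then have "\<bar>(\<phi> z - \<phi> (z - T n *\<^sub>R e)) / T n\<bar> \<le> M1"
            using T[of n] by (simp add: pos_divide_le_eq)
          from mult_left_mono[OF this, of "\<bar>u z\<bar>"] show ?thesis
            using True unfolding S1_def real_norm_def abs_mult by (simp add: mult.commute)
        next
          case False
          then show ?thesis using R(2)[of z] shift0[of z n] by (simp add: S1_def)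
        qed
      qed
    qed
    have lim2: "(\<lambda>n. integral\<^sup>L lebesgue (S2 n)) \<longlonglongrightarrow> (LINT z|lebesgue. g z $ i * \<phi> z)"
    proof (rule integral_dominated_convergence)
      have "(\<lambda>z. g z $ i) \<in> borel_measurable lebesgue"
        using borel_measurable_inner[OF G(4) borel_measurable_const[of "axis i 1"]] by (simp add: inner_axis)
      then show "(\<lambda>z. g z $ i * \<phi> z) \<in> borel_measurable lebesgue"
        by (rule borel_measurable_times[OF _ continuous_borel_lebesgue(3)[OF c\<phi>]])
      show "S2 n \<in> borel_measurable lebesgue" for n
        unfolding S2_def by (intro continuous_borel_lebesgue(3) continuous_intros G(3) c\<phi>)
      \<comment> \<open>The quotients of u are unbounded near the origin, but |z|^(\<sigma> - 1)
        dominates them there and is integrable.\<close>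
      show "integrable lebesgue (\<lambda>z::real^'n. (C * M0) *\<^sub>R (indicator (ball 0 R) z *\<^sub>R norm z powr (\<sigma> - 1)))"
        using set_integrable_norm_powr_ball[of R "\<sigma> - 1", where 'a = "real^'n"] R \<sigma> e1
        unfolding set_integrable_def by (intro integrable_scaleR_right) auto
      show "AE z in lebesgue. (\<lambda>n. S2 n z) \<longlonglongrightarrow> g z $ i * \<phi> z"
        using G(1) by eventually_elim (auto simp: S2_def intro!: tendsto_mult_right)
      show "AE z in lebesgue. norm (S2 n z) \<le> (C * M0) *\<^sub>R (indicator (ball 0 R) z *\<^sub>R norm z powr (\<sigma> - 1))" for n
        using nz
      proof eventually_elim
        fix z :: "real^'n" assume z: "z \<noteq> 0"
        show "norm (S2 n z) \<le> (C * M0) *\<^sub>R (indicator (ball 0 R) z *\<^sub>R norm z powr (\<sigma> - 1))"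
        proof (cases "norm z < R")
          case True
          have "\<bar>dq i n z\<bar> * \<bar>\<phi> z\<bar> \<le> (C * norm z powr (\<sigma> - 1)) * M0"
            by (intro mult_mono G(2) z M0) (use M0 u in \<open>auto simp: homogeneous_lipschitz_def\<close>)
          then show ?thesis using True by (simp add: S2_def abs_mult mult_ac)
        next
          case False
          then show ?thesis using R(2)[of z] by (simp add: S2_def)
        qed
      qed
    qed
    have "(\<lambda>n. - integral\<^sup>L lebesgue (S1 n)) \<longlonglongrightarrow> (LINT z|lebesgue. g z $ i * \<phi> z)"
      using lim2 by (simp add: S12)
    then have "(LINT z|lebesgue. g z $ i * \<phi> z) = - (LINT z|lebesgue. u z * partial_deriv i \<phi> z)"
      using tendsto_minus[OF lim1] LIMSEQ_unique by blast
    then show "(LINT z|lebesgue. u z * partial_deriv i \<phi> z) = - (LINT z|lebesgue. g z $ i * \<phi> z)"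
      by simp
  qed
qed

text \<open>Both sides equal minus the integral of u against a second derivative of \<phi>, and the
  order of differentiation does not matter.\<close>

lemma weak_gradient_curl_free:
  assumes "has_weak_gradient u g" "test_function \<phi>"
  shows "(LINT z|lebesgue. g z $ i * partial_deriv j \<phi> z) = (LINT z|lebesgue. g z $ j * partial_deriv i \<phi> z)"
proof -
  have "(LINT z|lebesgue. g z $ k * partial_deriv l \<phi> z)
      = - (LINT z|lebesgue. u z * partial_deriv k (partial_deriv l \<phi>) z)" for k l
    using assms test_function_partial_deriv[OF assms(2), of l] by (simp add: has_weak_gradient_def)
  then show ?thesis
    using mixed_partials_commute[OF test_function_smooth(4)[OF assms(2)], of i j] by simp
qed

section \<open>Calculus of bounded Lipschitz functions on a set\<close>

definition bounded_lipschitz :: "'a::real_normed_vector set \<Rightarrow> ('a \<Rightarrow> real) \<Rightarrow> bool" where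
  "bounded_lipschitz K u \<longleftrightarrow> (\<exists>M L. 0 \<le> M \<and> 0 \<le> L \<and> (\<forall>z\<in>K. \<bar>u z\<bar> \<le> M) \<and>
     (\<forall>z\<in>K. \<forall>w\<in>K. \<bar>u z - u w\<bar> \<le> L * norm (z - w)))"

lemma bounded_lipschitzI:
  assumes "0 \<le> M" "0 \<le> L" "\<And>z. z \<in> K \<Longrightarrow> \<bar>u z\<bar> \<le> M"
    "\<And>z w. z \<in> K \<Longrightarrow> w \<in> K \<Longrightarrow> \<bar>u z - u w\<bar> \<le> L * norm (z - w)"
  shows "bounded_lipschitz K u"
  unfolding bounded_lipschitz_def using assms by blast

lemma bounded_lipschitzE:
  assumes "bounded_lipschitz K u"
  obtains M L where "0 \<le> M" "0 \<le> L" "\<And>z. z \<in> K \<Longrightarrow> \<bar>u z\<bar> \<le> M"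
    "\<And>z w. z \<in> K \<Longrightarrow> w \<in> K \<Longrightarrow> \<bar>u z - u w\<bar> \<le> L * norm (z - w)"
  using assms unfolding bounded_lipschitz_def by blast

lemma bounded_lipschitz_cong:
  assumes "bounded_lipschitz K u" "\<And>z. z \<in> K \<Longrightarrow> u z = v z"
  shows "bounded_lipschitz K v"
proof -
  obtain M L where "0 \<le> M" "0 \<le> L" "\<And>z. z \<in> K \<Longrightarrow> \<bar>u z\<bar> \<le> M"
    "\<And>z w. z \<in> K \<Longrightarrow> w \<in> K \<Longrightarrow> \<bar>u z - u w\<bar> \<le> L * norm (z - w)"
    using assms(1) by (rule bounded_lipschitzE) blast
  then show ?thesis
    by (intro bounded_lipschitzI[of M L]) (auto simp flip: assms(2))
qed

lemma bounded_lipschitz_const: "bounded_lipschitz K (\<lambda>_. c)"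
  by (rule bounded_lipschitzI[of "\<bar>c\<bar>" 0]) auto

lemma bounded_lipschitz_component:
  fixes K :: "(real^'n) set"
  assumes "K \<subseteq> cball 0 R"
  shows "bounded_lipschitz K (\<lambda>z. z $ i)"
proof (rule bounded_lipschitzI[of "\<bar>R\<bar>" 1])
  fix z assume "z \<in> K"
  then have "norm z \<le> R" using assms by auto
  then show "\<bar>z $ i\<bar> \<le> \<bar>R\<bar>" using component_le_norm_cart[of z i] by linarith
next
  fix z w :: "real^'n"
  show "\<bar>z $ i - w $ i\<bar> \<le> 1 * norm (z - w)" using component_le_norm_cart[of "z - w" i] by simp
qed auto

lemma bounded_lipschitz_add:
  assumes "bounded_lipschitz K u" "bounded_lipschitz K v"
  shows "bounded_lipschitz K (\<lambda>z. u z + v z)"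
proof -
  obtain M L where u: "0 \<le> M" "0 \<le> L" "\<And>z. z \<in> K \<Longrightarrow> \<bar>u z\<bar> \<le> M"
    "\<And>z w. z \<in> K \<Longrightarrow> w \<in> K \<Longrightarrow> \<bar>u z - u w\<bar> \<le> L * norm (z - w)"
    using assms(1) by (rule bounded_lipschitzE) blast
  obtain M' L' where v: "0 \<le> M'" "0 \<le> L'" "\<And>z. z \<in> K \<Longrightarrow> \<bar>v z\<bar> \<le> M'"
    "\<And>z w. z \<in> K \<Longrightarrow> w \<in> K \<Longrightarrow> \<bar>v z - v w\<bar> \<le> L' * norm (z - w)"
    using assms(2) by (rule bounded_lipschitzE) blast
  show ?thesis
  proof (rule bounded_lipschitzI[of "M + M'" "L + L'"])
    show "\<bar>u z + v z\<bar> \<le> M + M'" if "z \<in> K" for z using u(3)[OF that] v(3)[OF that] by linarith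
    show "\<bar>u z + v z - (u w + v w)\<bar> \<le> (L + L') * norm (z - w)" if "z \<in> K" "w \<in> K" for z w
      using u(4)[OF that] v(4)[OF that] unfolding distrib_right by linarith
  qed (use u v in auto)
qed

text \<open>Products are the reason for carrying a bound along with the Lipschitz constant.\<close>

lemma bounded_lipschitz_mult:
  assumes "bounded_lipschitz K u" "bounded_lipschitz K v"
  shows "bounded_lipschitz K (\<lambda>z. u z * v z)"
proof -
  obtain M L where u: "0 \<le> M" "0 \<le> L" "\<And>z. z \<in> K \<Longrightarrow> \<bar>u z\<bar> \<le> M"
    "\<And>z w. z \<in> K \<Longrightarrow> w \<in> K \<Longrightarrow> \<bar>u z - u w\<bar> \<le> L * norm (z - w)"
    using assms(1) by (rule bounded_lipschitzE) blast
  obtain M' L' where v: "0 \<le> M'" "0 \<le> L'" "\<And>z. z \<in> K \<Longrightarrow> \<bar>v z\<bar> \<le> M'"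
    "\<And>z w. z \<in> K \<Longrightarrow> w \<in> K \<Longrightarrow> \<bar>v z - v w\<bar> \<le> L' * norm (z - w)"
    using assms(2) by (rule bounded_lipschitzE) blast
  show ?thesis
  proof (rule bounded_lipschitzI[of "M * M'" "M * L' + M' * L"])
    show "\<bar>u z * v z\<bar> \<le> M * M'" if "z \<in> K" for z
      unfolding abs_mult using u(3)[OF that] v(3)[OF that] u(1) by (intro mult_mono) auto
    show "\<bar>u z * v z - u w * v w\<bar> \<le> (M * L' + M' * L) * norm (z - w)" if zw: "z \<in> K" "w \<in> K" for z w
    proof -
      have "u z * v z - u w * v w = u z * (v z - v w) + v w * (u z - u w)" by (simp add: algebra_simps)
      then have "\<bar>u z * v z - u w * v w\<bar> \<le> \<bar>u z\<bar> * \<bar>v z - v w\<bar> + \<bar>v w\<bar> * \<bar>u z - u w\<bar>"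
        by (metis abs_mult abs_triangle_ineq)
      also have "\<dots> \<le> M * (L' * norm (z - w)) + M' * (L * norm (z - w))"
        using u v zw by (intro add_mono mult_mono) auto
      finally show ?thesis by (simp add: algebra_simps)
    qed
  qed (use u v in auto)
qed

lemma bounded_lipschitz_max:
  assumes "bounded_lipschitz K u" "bounded_lipschitz K v"
  shows "bounded_lipschitz K (\<lambda>z. max (u z) (v z))"
proof -
  obtain M L where u: "0 \<le> M" "0 \<le> L" "\<And>z. z \<in> K \<Longrightarrow> \<bar>u z\<bar> \<le> M"
    "\<And>z w. z \<in> K \<Longrightarrow> w \<in> K \<Longrightarrow> \<bar>u z - u w\<bar> \<le> L * norm (z - w)"
    using assms(1) by (rule bounded_lipschitzE) blast
  obtain M' L' where v: "0 \<le> M'" "0 \<le> L'" "\<And>z. z \<in> K \<Longrightarrow> \<bar>v z\<bar> \<le> M'"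
    "\<And>z w. z \<in> K \<Longrightarrow> w \<in> K \<Longrightarrow> \<bar>v z - v w\<bar> \<le> L' * norm (z - w)"
    using assms(2) by (rule bounded_lipschitzE) blast
  show ?thesis
  proof (rule bounded_lipschitzI[of "M + M'" "L + L'"])
    show "\<bar>max (u z) (v z)\<bar> \<le> M + M'" if "z \<in> K" for z using u(3)[OF that] v(3)[OF that] by linarith
    show "\<bar>max (u z) (v z) - max (u w) (v w)\<bar> \<le> (L + L') * norm (z - w)" if "z \<in> K" "w \<in> K" for z w
    proof -
      have "\<bar>max (u z) (v z) - max (u w) (v w)\<bar> \<le> \<bar>u z - u w\<bar> + \<bar>v z - v w\<bar>" by linarith
      then show ?thesis using u(4)[OF that] v(4)[OF that] unfolding distrib_right by linarith
    qed
  qed (use u v in auto)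
qed

text \<open>The derivative bound is used on the interval of values, which is convex; K itself need
  not be convex, and the annulus to which this is applied is not.\<close>

lemma bounded_lipschitz_compose:
  assumes u: "bounded_lipschitz K u" and range: "\<And>z. z \<in> K \<Longrightarrow> u z \<in> {c..d}"
    and D: "\<And>x. x \<in> {c..d} \<Longrightarrow> DERIV g x :> g' x" and cont: "continuous_on {c..d} g'"
  shows "bounded_lipschitz K (\<lambda>z. g (u z))"
proof -
  obtain M L where u: "0 \<le> M" "0 \<le> L" "\<And>z. z \<in> K \<Longrightarrow> \<bar>u z\<bar> \<le> M"
    "\<And>z w. z \<in> K \<Longrightarrow> w \<in> K \<Longrightarrow> \<bar>u z - u w\<bar> \<le> L * norm (z - w)"
    using assms(1) by (rule bounded_lipschitzE) blast
  have cg: "continuous_on {c..d} g"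
    by (intro continuous_at_imp_continuous_on ballI DERIV_isCont[OF D])
  obtain B where B: "\<And>x. x \<in> {c..d} \<Longrightarrow> \<bar>g x\<bar> \<le> B"
    using compact_imp_bounded[OF compact_continuous_image[OF cg compact_Icc]]
    unfolding bounded_iff real_norm_def by blast
  obtain B' where B': "\<And>x. x \<in> {c..d} \<Longrightarrow> \<bar>g' x\<bar> \<le> B'"
    using compact_imp_bounded[OF compact_continuous_image[OF cont compact_Icc]]
    unfolding bounded_iff real_norm_def by blast
  have lip: "\<bar>g x - g y\<bar> \<le> \<bar>B'\<bar> * \<bar>x - y\<bar>" if "x \<in> {c..d}" "y \<in> {c..d}" for x y
  proof -
    have "norm (g x - g y) \<le> \<bar>B'\<bar> * norm (x - y)"
    proof (rule field_differentiable_bound[of "{c..d}"])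
      show "(g has_field_derivative g' z) (at z within {c..d})" if "z \<in> {c..d}" for z
        using D[OF that] by (rule has_field_derivative_at_within)
      show "norm (g' z) \<le> \<bar>B'\<bar>" if "z \<in> {c..d}" for z
        using B'[OF that] by (simp add: abs_le_iff)
    qed (use that in auto)
    then show ?thesis by simp
  qed
  show ?thesis
  proof (rule bounded_lipschitzI[of "\<bar>B\<bar>" "\<bar>B'\<bar> * L"])
    show "\<bar>g (u z)\<bar> \<le> \<bar>B\<bar>" if "z \<in> K" for z using B[OF range[OF that]] by linarith
    show "\<bar>g (u z) - g (u w)\<bar> \<le> \<bar>B'\<bar> * L * norm (z - w)" if zw: "z \<in> K" "w \<in> K" for z w
    proof -
      have "\<bar>g (u z) - g (u w)\<bar> \<le> \<bar>B'\<bar> * \<bar>u z - u w\<bar>" using lip range zw by blast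
      also have "\<dots> \<le> \<bar>B'\<bar> * (L * norm (z - w))" using u(4)[OF zw] by (rule mult_left_mono) simp
      finally show ?thesis by (simp only: mult.assoc)
    qed
  qed (use u in auto)
qed

lemma bounded_lipschitz_powr:
  assumes "bounded_lipschitz K u" "\<And>z. z \<in> K \<Longrightarrow> c \<le> u z" "0 < c"
  shows "bounded_lipschitz K (\<lambda>z. u z powr p)"
proof -
  obtain M where M: "\<And>z. z \<in> K \<Longrightarrow> \<bar>u z\<bar> \<le> M"
    using assms(1) by (rule bounded_lipschitzE) blast
  show ?thesis
  proof (rule bounded_lipschitz_compose[of K u c M "\<lambda>x. x powr p" "\<lambda>x. p * x powr (p - 1)"])
    show "u z \<in> {c..M}" if "z \<in> K" for z using assms(2)[OF that] M[OF that] by auto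
    show "DERIV (\<lambda>x. x powr p) x :> p * x powr (p - 1)" if "x \<in> {c..M}" for x
      using that assms(3) by (intro has_real_derivative_powr) auto
    show "continuous_on {c..M} (\<lambda>x. p * x powr (p - 1))"
      using assms(3) by (intro continuous_intros) auto
  qed (rule assms)
qed

text \<open>Dividing both points by the larger norm puts one on the unit sphere and the other into
  the closed unit ball. Either the second point also lies in the annulus, or the two are at least
  1/2 apart and boundedness suffices.\<close>

lemma homogeneous_lipschitz_from_annulus:
  fixes u :: "real^'n \<Rightarrow> real"
  assumes \<sigma>: "0 < \<sigma>" "\<sigma> < 1" and hom: "homogeneous \<sigma> u" and u0: "u 0 = 0"
    and lip: "bounded_lipschitz {z. 1/2 \<le> norm z \<and> norm z \<le> 1} u"
  shows "\<exists>C. homogeneous_lipschitz \<sigma> C u"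
proof -
  obtain M L where ub: "0 \<le> M" "0 \<le> L"
    "\<And>z. 1/2 \<le> norm z \<Longrightarrow> norm z \<le> 1 \<Longrightarrow> \<bar>u z\<bar> \<le> M"
    "\<And>z w. 1/2 \<le> norm z \<Longrightarrow> norm z \<le> 1 \<Longrightarrow> 1/2 \<le> norm w \<Longrightarrow> norm w \<le> 1 \<Longrightarrow> \<bar>u z - u w\<bar> \<le> L * norm (z - w)"
    using lip by (rule bounded_lipschitzE) blast
  have H: "u (t *\<^sub>R z) = t powr \<sigma> * u z" if "t > 0" for t z
    using hom that by (simp add: homogeneous_def)
  have bd: "\<bar>u z\<bar> \<le> M" if "norm z \<le> 1" for z
  proof (cases "z = 0")
    case False
    define z' where "z' = (1 / norm z) *\<^sub>R z"
    have z: "z = norm z *\<^sub>R z'" "norm z' = 1" using False by (auto simp: z'_def)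
    have "\<bar>u z\<bar> = norm z powr \<sigma> * \<bar>u z'\<bar>"
      using H[of "norm z" z'] z False by (simp add: abs_mult)
    also have "\<dots> \<le> 1 * M"
      using that \<sigma> ub(1) ub(3)[of z'] z(2) by (intro mult_mono) (auto intro: powr_le1)
    finally show ?thesis by simp
  qed (use u0 ub in auto)
  \<comment> \<open>At distance at least 1/2 the summand 4 M contributes at least 2 M, which covers
    the difference of two values bounded by M.\<close>
  define C where "C = L + 4 * M"
  have one: "\<bar>u z - u w\<bar> \<le> C * norm (z - w)" if z: "norm z = 1" and w: "norm w \<le> 1" for z w
  proof (cases "norm w \<ge> 1/2")
    case True
    have "\<bar>u z - u w\<bar> \<le> L * norm (z - w)" using ub(4)[of z w] z w True by simp
    also have "\<dots> \<le> C * norm (z - w)" using ub by (intro mult_right_mono) (auto simp: C_def)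
    finally show ?thesis .
  next
    case False
    have "norm (z - w) \<ge> norm z - norm w" by (rule norm_triangle_ineq2)
    then have "norm (z - w) \<ge> 1/2" using z False by simp
    then have "4 * M * norm (z - w) \<ge> 4 * M * (1/2)" using ub by (intro mult_left_mono) auto
    moreover have "\<bar>u z - u w\<bar> \<le> 2 * M" using bd[of z] bd[of w] z w by simp
    moreover have "L * norm (z - w) \<ge> 0" using ub by simp
    ultimately show ?thesis by (simp add: C_def distrib_right)
  qed
  have "homogeneous_lipschitz \<sigma> C u"
    unfolding homogeneous_lipschitz_def
  proof (intro conjI allI impI)
    show "C \<ge> 0" using ub by (simp add: C_def)
    fix z w :: "real^'n" assume z0: "z \<noteq> 0"
    define m where "m = max (norm z) (norm w)"
    have m: "m > 0" "norm z \<le> m" "norm w \<le> m" using z0 by (auto simp: m_def less_max_iff_disj)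
    define z' w' where "z' = (1 / m) *\<^sub>R z" and "w' = (1 / m) *\<^sub>R w"
    have zz: "z = m *\<^sub>R z'" and ww: "w = m *\<^sub>R w'" using m by (auto simp: z'_def w'_def)
    have n: "norm z' \<le> 1" "norm w' \<le> 1" "norm z' = 1 \<or> norm w' = 1"
      using m by (auto simp: z'_def w'_def m_def max_def split: if_splits)
    have "\<bar>u z' - u w'\<bar> \<le> C * norm (z' - w')"
      using n one[of z' w'] one[of w' z'] by (auto simp: abs_minus_commute norm_minus_commute)
    moreover have "u z - u w = m powr \<sigma> * (u z' - u w')"
      using H[OF m(1), of z'] H[OF m(1), of w'] zz ww by (simp add: right_diff_distrib)
    ultimately have "\<bar>u z - u w\<bar> \<le> m powr \<sigma> * (C * norm (z' - w'))"
      by (simp add: abs_mult mult_left_mono)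
    also have "norm (z' - w') = norm (z - w) / m"
      unfolding z'_def w'_def using m by (simp flip: scaleR_diff_right)
    also have "m powr \<sigma> * (C * (norm (z - w) / m)) = C * norm (z - w) * m powr (\<sigma> - 1)"
      using m by (simp add: powr_diff)
    \<comment> \<open>The exponent \<sigma> - 1 is negative, so replacing m by the smaller number
      |z| only enlarges the right-hand side.\<close>
    also have "\<dots> \<le> C * norm (z - w) * norm z powr (\<sigma> - 1)"
      using m z0 \<sigma> ub by (intro mult_left_mono powr_mono2') (auto simp: C_def)
    finally show "\<bar>u z - u w\<bar> \<le> C * norm (z - w) * norm z powr (\<sigma> - 1)" .
  qed
  then show ?thesis ..
qed

lemma homogeneous_lipschitz_diff:
  assumes "homogeneous_lipschitz \<sigma> C u" "homogeneous_lipschitz \<sigma> D v"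
  shows "homogeneous_lipschitz \<sigma> (C + D) (\<lambda>z. u z - v z)"
  unfolding homogeneous_lipschitz_def
proof (intro conjI allI impI)
  show "0 \<le> C + D" using assms by (simp add: homogeneous_lipschitz_def)
  fix z w :: "real^'a" assume z: "z \<noteq> 0"
  have "\<bar>u z - u w\<bar> \<le> C * (norm (z - w) * norm z powr (\<sigma> - 1))"
    "\<bar>v z - v w\<bar> \<le> D * (norm (z - w) * norm z powr (\<sigma> - 1))"
    using assms z by (auto simp: homogeneous_lipschitz_def mult.assoc)
  then show "\<bar>(u z - v z) - (u w - v w)\<bar> \<le> (C + D) * norm (z - w) * norm z powr (\<sigma> - 1)"
    unfolding mult.assoc distrib_right by linarith
qed

text \<open>If the estimate is centred at the point z of larger norm, then |z - w| \<le> 2 |z|. The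
  negative power of |z| is therefore at most the same power of |z - w| / 2, and the exponents add up
  to \<sigma>.\<close>

lemma homogeneous_lipschitz_holder:
  assumes u: "homogeneous_lipschitz \<sigma> C u" and \<sigma>: "0 < \<sigma>" "\<sigma> < 1"
  shows "holder_loc \<sigma> u"
proof -
  have C: "C \<ge> 0" using u by (simp add: homogeneous_lipschitz_def)
  have *: "\<bar>u z - u w\<bar> \<le> 2 * C * norm (z - w) powr \<sigma>" if "norm w \<le> norm z" for z w
  proof (cases "z = w")
    case False
    then have z: "z \<noteq> 0" using that by auto
    have zw: "norm (z - w) > 0" using False by simp
    have "norm (z - w) \<le> 2 * norm z" using norm_triangle_ineq4[of z w] that by simp
    then have le: "norm (z - w) / 2 \<le> norm z" by simp
    have "\<bar>u z - u w\<bar> \<le> C * norm (z - w) * norm z powr (\<sigma> - 1)"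
      using u z by (simp add: homogeneous_lipschitz_def)
    also have "\<dots> \<le> C * norm (z - w) * (norm (z - w) / 2) powr (\<sigma> - 1)"
      using le zw C \<sigma> by (intro mult_left_mono powr_mono2') auto
    also have "(norm (z - w) / 2) powr (\<sigma> - 1) = norm (z - w) powr (\<sigma> - 1) * 2 powr (1 - \<sigma>)"
      by (simp add: powr_divide powr_diff)
    also have "\<dots> \<le> norm (z - w) powr (\<sigma> - 1) * 2"
      using \<sigma> powr_mono[of "1 - \<sigma>" 1 2] by (intro mult_left_mono) auto
    also have "C * norm (z - w) * (norm (z - w) powr (\<sigma> - 1) * 2) = 2 * C * norm (z - w) powr \<sigma>"
      using zw by (simp add: powr_diff)
    finally show ?thesis using C zw by (simp add: mult_left_mono)
  qed auto
  have "\<bar>u z - u w\<bar> \<le> 2 * C * norm (z - w) powr \<sigma>" for z w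
    using *[of w z] *[of z w] by (cases "norm w \<le> norm z") (auto simp: abs_minus_commute norm_minus_commute)
  then show ?thesis unfolding holder_loc_def by blast
qed

text \<open>On the ray through z, division by t^\<sigma> turns the bound into |q z| \<le> N
  t^(\<beta> - \<sigma>), whose right-hand side tends to 0.\<close>

lemma homogeneous_not_holder_at_origin:
  fixes q :: "real^'n \<Rightarrow> real"
  assumes hom: "homogeneous \<sigma> q" and q0: "q 0 = 0" and qz: "q z \<noteq> 0" and \<beta>: "\<beta> > \<sigma>"
  shows "\<not> holder_at_origin \<beta> q"
proof
  assume "holder_at_origin \<beta> q"
  then obtain C r where C: "C > 0" and r: "r > 0"
    and bd: "\<And>w. norm w < r \<Longrightarrow> \<bar>q w - q 0\<bar> \<le> C * norm w powr \<beta>"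
    unfolding holder_at_origin_def by blast
  have z: "z \<noteq> 0" using qz q0 by auto
  define N where "N = C * norm z powr \<beta>"
  have ev: "\<bar>q z\<bar> \<le> N * t powr (\<beta> - \<sigma>)" if t: "0 < t" "t < r / norm z" for t
  proof -
    have "norm (t *\<^sub>R z) < r" using t z by (simp add: pos_less_divide_eq)
    from bd[OF this] have "\<bar>q (t *\<^sub>R z)\<bar> \<le> C * norm (t *\<^sub>R z) powr \<beta>" using q0 by simp
    moreover have "q (t *\<^sub>R z) = t powr \<sigma> * q z" using hom t by (simp add: homogeneous_def)
    ultimately have "t powr \<sigma> * \<bar>q z\<bar> \<le> t powr \<beta> * N"
      using t by (simp add: abs_mult powr_mult N_def mult_ac)
    then show ?thesis using t by (simp add: powr_diff field_simps)
  qed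
  have "((\<lambda>t. N * t powr (\<beta> - \<sigma>)) \<longlongrightarrow> N * 0) (at_right 0)"
  proof (rule tendsto_mult_left)
    have "((\<lambda>t. t powr (\<beta> - \<sigma>)) \<longlongrightarrow> 0 powr (\<beta> - \<sigma>)) (at_right (0::real))"
      using \<beta> by (intro tendsto_powr2 tendsto_const tendsto_ident_at) (auto simp: eventually_at_filter)
    then show "((\<lambda>t. t powr (\<beta> - \<sigma>)) \<longlongrightarrow> 0) (at_right (0::real))" by simp
  qed
  moreover have "\<forall>\<^sub>F t in at_right 0. \<bar>q z\<bar> \<le> N * t powr (\<beta> - \<sigma>)"
    using eventually_at_right_real[of 0 "r / norm z"] r z ev by (auto elim!: eventually_mono)
  ultimately have "\<bar>q z\<bar> \<le> N * 0"
    by (intro tendsto_lowerbound[of _ _ "at_right (0::real)"]) auto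
  then show False using qz by simp
qed

section \<open>The Legendre function\<close>

text \<open>The coefficients of the hypergeometric series \<open>F(- \<alpha>, 1 + \<alpha>; 1; w)\<close> with
  \<open>c = \<alpha> (\<alpha> + 1)\<close>, that is, of the Legendre function \<open>P\<^sub>\<alpha> (1 - 2 w)\<close>.\<close>

primrec legendre_coeff :: "real \<Rightarrow> nat \<Rightarrow> real" where
  "legendre_coeff c 0 = 1"
| "legendre_coeff c (Suc n) =
     (real n * (real n + 1) - c) / (real n + 1)\<^sup>2 * legendre_coeff c n"

definition legendre :: "real \<Rightarrow> real \<Rightarrow> real" where
  "legendre c w = (\<Sum>n. legendre_coeff c n * w ^ n)"

definition legendre' :: "real \<Rightarrow> real \<Rightarrow> real" where
  "legendre' c w = (\<Sum>n. diffs (legendre_coeff c) n * w ^ n)"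

definition legendre'' :: "real \<Rightarrow> real \<Rightarrow> real" where
  "legendre'' c w = (\<Sum>n. diffs (diffs (legendre_coeff c)) n * w ^ n)"

text \<open>The coefficient of w is -c, and every later ratio of consecutive coefficients lies
  between 0 and 1.\<close>

lemma legendre_coeff_bounds:
  assumes "0 < c" "c < 1"
  shows "- c \<le> legendre_coeff c (Suc n)" "legendre_coeff c (Suc n) < 0"
proof (induction n)
  case 0
  {
    case 1 show ?case by simp
  next
    case 2 show ?case using assms by simp
  }
next
  case (Suc n)
  define k where "k = ((real n + 1) * (real n + 2) - c) / (real n + 2)\<^sup>2"
  have eq: "legendre_coeff c (Suc (Suc n)) = k * legendre_coeff c (Suc n)"
    unfolding k_def legendre_coeff.simps(2)[of c "Suc n"] by (simp add: add.commute[of 2])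
  have "(real n + 1) * (real n + 2) \<ge> 1 * 1" by (intro mult_mono) auto
  then have k0: "0 < k" unfolding k_def using assms by (intro divide_pos_pos) auto
  have "(real n + 1) * (real n + 2) - c \<le> (real n + 2)\<^sup>2"
    using assms by (simp add: power2_eq_square algebra_simps)
  then have k1: "k \<le> 1"
    unfolding k_def by (simp add: divide_le_eq_1_pos zero_less_power2 add_nonneg_eq_0_iff)
  {
    case 1
    have "k * legendre_coeff c (Suc n) \<ge> 1 * legendre_coeff c (Suc n)"
      using k1 Suc.IH(2) by (intro mult_right_mono_neg) auto
    then show ?case using Suc.IH(1) eq by simp
  next
    case 2 show ?case unfolding eq using k0 Suc.IH(2) by (rule mult_pos_neg)
  }
qed

text \<open>From index x to x + 1, index times coefficient is multiplied by 1 - c / (x (x + 1)). A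
  product of such factors is at least 1 minus the sum of the subtracted terms, and that sum
  telescopes to c (1 - 1 / x), which is the induction hypothesis.\<close>

lemma legendre_coeff_lower_decay:
  assumes "0 < c" "c < 1"
  shows "- legendre_coeff c (Suc n) \<ge> c * (1 - c) / real (Suc n)"
proof -
  have "real (Suc n) * - legendre_coeff c (Suc n) \<ge> c * (1 - c * (1 - 1 / real (Suc n)))"
  proof (induction n)
    case 0 show ?case by simp
  next
    case (Suc n)
    define x where "x = real (Suc n)"
    have x: "x \<ge> 1" by (simp add: x_def)
    have eq: "legendre_coeff c (Suc (Suc n)) = (x * (x + 1) - c) / (x + 1)\<^sup>2 * legendre_coeff c (Suc n)"
      by (simp only: legendre_coeff.simps(2)[of c "Suc n"] x_def)
    have "real (Suc (Suc n)) * - legendre_coeff c (Suc (Suc n))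
        = (1 - c / (x * (x + 1))) * (x * - legendre_coeff c (Suc n))"
    proof -
      have "real (Suc (Suc n)) = x + 1" by (simp add: x_def)
      moreover have "(x + 1) * - ((x * (x + 1) - c) / (x + 1)\<^sup>2 * y) = (1 - c / (x * (x + 1))) * (x * - y)" for y
        using x by (simp add: divide_simps power2_eq_square)
      ultimately show ?thesis unfolding eq by (simp only:)
    qed
    also have "\<dots> \<ge> (1 - c / (x * (x + 1))) * (c * (1 - c * (1 - 1 / x)))"
    proof (rule mult_left_mono)
      show "c * (1 - c * (1 - 1 / x)) \<le> x * - legendre_coeff c (Suc n)" using Suc.IH by (simp only: x_def)
      have "x * (x + 1) \<ge> 1 * 1" using x by (intro mult_mono) auto
      then show "0 \<le> 1 - c / (x * (x + 1))" using assms by (simp add: pos_divide_le_eq)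
    qed
    \<comment> \<open>The inequality (1 - a) (1 - b) \<ge> 1 - (a + b), with a the new term and b
      the telescoped sum so far.\<close>
    also have "(1 - c / (x * (x + 1))) * (c * (1 - c * (1 - 1 / x))) \<ge> c * (1 - c * (1 - 1 / (x + 1)))"
    proof -
      define a b where "a = c / (x * (x + 1))" and "b = c * (1 - 1 / x)"
      have ab: "a \<ge> 0" "b \<ge> 0" using x assms by (auto simp: a_def b_def)
      have "c * (1 - 1 / (x + 1)) = a + b" using x by (simp add: a_def b_def divide_simps) (simp add: algebra_simps)
      moreover have "1 - (a + b) \<le> (1 - a) * (1 - b)" using mult_nonneg_nonneg[OF ab] by (simp add: algebra_simps)
      ultimately have "c * (1 - c * (1 - 1 / (x + 1))) \<le> c * ((1 - a) * (1 - b))"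
        using assms by (intro mult_left_mono) auto
      then show ?thesis unfolding a_def b_def by (simp only: mult.left_commute)
    qed
    finally show ?case by (simp add: x_def add.commute)
  qed
  moreover have "c * (1 - c * (1 - 1 / real (Suc n))) \<ge> c * (1 - c * 1)"
    using assms by (intro mult_left_mono diff_left_mono) auto
  ultimately have "c * (1 - c * 1) \<le> real (Suc n) * - legendre_coeff c (Suc n)" by (rule order_trans[rotated])
  then show ?thesis by (simp only: pos_divide_le_eq of_nat_0_less_iff zero_less_Suc mult.commute mult_1_left)
qed

context
  fixes c :: real
  assumes c: "0 < c" "c < 1"
begin

lemma legendre_summable: "\<bar>w\<bar> < 1 \<Longrightarrow> summable (\<lambda>n. legendre_coeff c n * w ^ n)"
proof (rule summable_comparison_test')
  assume w: "\<bar>w\<bar> < 1"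
  then show "summable (\<lambda>n. \<bar>w\<bar> ^ n)" by (intro summable_geometric) auto
  fix n
  have "\<bar>legendre_coeff c n\<bar> \<le> 1"
    using legendre_coeff_bounds[OF c, of "n - 1"] c
    by (cases n) (auto simp del: legendre_coeff.simps(2))
  then show "norm (legendre_coeff c n * w ^ n) \<le> \<bar>w\<bar> ^ n"
    by (simp add: abs_mult power_abs mult_left_le_one_le)
qed

lemma legendre'_summable: "\<bar>w\<bar> < 1 \<Longrightarrow> summable (\<lambda>n. diffs (legendre_coeff c) n * w ^ n)"
  using termdiff_converges[of w 1 "legendre_coeff c"] legendre_summable by simp

lemma legendre''_summable: "\<bar>w\<bar> < 1 \<Longrightarrow> summable (\<lambda>n. diffs (diffs (legendre_coeff c)) n * w ^ n)"
  using termdiff_converges[of w 1 "diffs (legendre_coeff c)"] legendre'_summable by simp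

lemma legendre_DERIV: "\<bar>w\<bar> < 1 \<Longrightarrow> DERIV (legendre c) w :> legendre' c w"
  unfolding legendre_def[abs_def] legendre'_def
  using termdiffs_strong'[of 1 "legendre_coeff c" w] legendre_summable by simp

lemma legendre'_DERIV: "\<bar>w\<bar> < 1 \<Longrightarrow> DERIV (legendre' c) w :> legendre'' c w"
  unfolding legendre'_def[abs_def] legendre''_def
  using termdiffs_strong'[of 1 "diffs (legendre_coeff c)" w] legendre'_summable by simp

lemma legendre''_isCont: "\<bar>w\<bar> < 1 \<Longrightarrow> isCont (legendre'' c) w"
  unfolding legendre''_def[abs_def]
  using termdiffs_strong'[of 1 "diffs (diffs (legendre_coeff c))" w] legendre''_summable
  by (intro DERIV_isCont) simp

text \<open>Comparison of coefficients: the coefficient of w^n on the left is (n + 1)^2 times the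
  next coefficient minus (n (n + 1) - c) times the present one, and the recursion says that this is
  zero.\<close>

lemma legendre_ODE:
  assumes w: "\<bar>w\<bar> < 1"
  shows "w * (1 - w) * legendre'' c w + (1 - 2 * w) * legendre' c w + c * legendre c w = 0"
proof -
  let ?a = "legendre_coeff c"
  \<comment> \<open>Multiplying a derivative by w multiplies the n-th coefficient of the original
    series by n and restores its index.\<close>
  have shift: "(\<lambda>n. real n * b n * w ^ n) sums (w * s)" if "(\<lambda>n. diffs b n * w ^ n) sums s" for b s
    by (rule sums_Suc_imp) (use sums_mult[OF that, of w] in \<open>simp_all add: diffs_def mult_ac\<close>)
  have s0: "(\<lambda>n. ?a n * w ^ n) sums legendre c w"
    unfolding legendre_def using legendre_summable[OF w] by (rule summable_sums)
  have s1: "(\<lambda>n. diffs ?a n * w ^ n) sums legendre' c w"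
    unfolding legendre'_def using legendre'_summable[OF w] by (rule summable_sums)
  have s2: "(\<lambda>n. diffs (diffs ?a) n * w ^ n) sums legendre'' c w"
    unfolding legendre''_def using legendre''_summable[OF w] by (rule summable_sums)
  note s3 = shift[OF s1] and s4 = shift[OF s2]
  have s5: "(\<lambda>n. real n * (real n - 1) * ?a n * w ^ n) sums (w * (w * legendre'' c w))"
    by (rule sums_Suc_imp) (use sums_mult[OF s4, of w] in \<open>simp_all add: diffs_def mult_ac\<close>)
  have "(\<lambda>n. real n * diffs ?a n * w ^ n - real n * (real n - 1) * ?a n * w ^ n + diffs ?a n * w ^ n
        - 2 * (real n * ?a n * w ^ n) + c * (?a n * w ^ n))
      sums (w * legendre'' c w - w * (w * legendre'' c w) + legendre' c w - 2 * (w * legendre' c w) + c * legendre c w)"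
    by (intro sums_add sums_diff sums_mult s0 s1 s3 s4 s5)
  moreover have "real n * diffs ?a n * w ^ n - real n * (real n - 1) * ?a n * w ^ n + diffs ?a n * w ^ n
        - 2 * (real n * ?a n * w ^ n) + c * (?a n * w ^ n) = 0" for n
  proof -
    have "(real n + 1) * diffs ?a n = (real n + 1)\<^sup>2 * ?a (Suc n)"
      by (simp add: diffs_def power2_eq_square algebra_simps)
    also have "\<dots> = (real n * (real n + 1) - c) * ?a n" by simp
    finally have "((real n + 1) * diffs ?a n - (real n * (real n + 1) - c) * ?a n) * w ^ n = 0" by simp
    then show ?thesis by (simp add: algebra_simps)
  qed
  ultimately have "w * legendre'' c w - w * (w * legendre'' c w) + legendre' c w
      - 2 * (w * legendre' c w) + c * legendre c w = 0"
    using sums_unique2[OF sums_zero] by (metis (no_types, lifting) ext)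
  then show ?thesis by (simp add: algebra_simps)
qed

text \<open>All coefficients of the derivative are negative, so its value is at most the constant
  term -c.\<close>

lemma legendre'_neg:
  assumes w: "0 \<le> w" "w < 1"
  shows "legendre' c w < 0"
proof -
  have s: "summable (\<lambda>n. - (diffs (legendre_coeff c) n * w ^ n))"
    using legendre'_summable[of w] w by (intro summable_minus) auto
  have "(\<Sum>n\<in>{0}. - (diffs (legendre_coeff c) n * w ^ n)) \<le> (\<Sum>n. - (diffs (legendre_coeff c) n * w ^ n))"
  proof (rule sum_le_suminf[OF s])
    fix n
    have "diffs (legendre_coeff c) n \<le> 0"
      unfolding diffs_def using legendre_coeff_bounds(2)[OF c, of n] by (intro mult_nonneg_nonpos) auto
    then show "0 \<le> - (diffs (legendre_coeff c) n * w ^ n)"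
      using w by (simp add: mult_nonpos_nonneg)
  qed auto
  also have "\<dots> = - legendre' c w"
    unfolding legendre'_def using w by (intro suminf_minus legendre'_summable) auto
  finally show ?thesis using c by (simp add: diffs_def)
qed

lemma legendre_strict_decreasing:
  assumes "0 \<le> v" "v < w" "w < 1"
  shows "legendre c w < legendre c v"
proof (rule DERIV_neg_imp_decreasing[OF assms(2)])
  fix x assume "v \<le> x" "x \<le> w"
  then show "\<exists>y. DERIV (legendre c) x :> y \<and> y < 0"
    using assms legendre_DERIV[of x] legendre'_neg[of x] by auto
qed

text \<open>For w \<ge> 0 the terms of this series are nonnegative, so bounds on the coefficients
  turn into bounds on the function.\<close>

lemma legendre_tail:
  assumes w: "0 \<le> w" "w < 1"
  shows "(\<lambda>n. - legendre_coeff c (Suc n) * w ^ Suc n) sums (1 - legendre c w)"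
proof -
  have "(\<lambda>n. legendre_coeff c n * w ^ n) sums legendre c w"
    unfolding legendre_def using legendre_summable[of w] w by (intro summable_sums) auto
  then have "(\<lambda>n. legendre_coeff c (Suc n) * w ^ Suc n) sums (legendre c w - 1)"
    by (subst sums_Suc_iff) simp
  from sums_minus[OF this] show ?thesis by simp
qed

text \<open>The coefficients are at least -c, so comparison with a geometric series of sum 1 gives a
  loss of at most c < 1. This keeps the zero away from 1/2.\<close>

lemma legendre_half_pos: "legendre c (1 / 2) > 0"
proof -
  have "1 - legendre c (1 / 2) \<le> c"
  proof (rule sums_le[OF _ legendre_tail])
    have "(\<lambda>n. (1 / 2 :: real) ^ Suc n) sums 1" by (rule power_half_series)
    from sums_mult[OF this, of c] show "(\<lambda>n. c * (1 / 2) ^ Suc n) sums c" by simp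
    show "- legendre_coeff c (Suc n) * (1 / 2) ^ Suc n \<le> c * (1 / 2) ^ Suc n" for n
      by (intro mult_right_mono) (use legendre_coeff_bounds(1)[OF c, of n] in auto)
  qed auto
  then show ?thesis using c by simp
qed

text \<open>If the function stayed nonnegative, the partial sums of the negated coefficients would
  be at most 1. They dominate a positive multiple of the harmonic series.\<close>

lemma legendre_negative_value: "\<exists>w. 0 < w \<and> w < 1 \<and> legendre c w < 0"
proof (rule ccontr)
  assume contra: "\<not> ?thesis"
  have bd: "(\<Sum>n<N. - legendre_coeff c (Suc n)) \<le> 1" for N
  proof -
    have pos: "0 \<le> - legendre_coeff c (Suc n)" for n
      using legendre_coeff_bounds(2)[OF c, of n] by simp
    have "(\<Sum>n<N. - legendre_coeff c (Suc n) * w ^ Suc n) \<le> 1" if w: "0 < w" "w < 1" for w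
    proof -
      note t = legendre_tail[of w]
      have "(\<Sum>n<N. - legendre_coeff c (Suc n) * w ^ Suc n) \<le> (\<Sum>n. - legendre_coeff c (Suc n) * w ^ Suc n)"
      proof (rule sum_le_suminf)
        show "summable (\<lambda>n. - legendre_coeff c (Suc n) * w ^ Suc n)" using t w by (intro sums_summable) auto
        show "0 \<le> - legendre_coeff c (Suc n) * w ^ Suc n" for n
          using w by (intro mult_nonneg_nonneg[OF pos]) auto
      qed auto
      also have "\<dots> = 1 - legendre c w" using t w by (intro sums_unique[symmetric]) auto
      also have "\<dots> \<le> 1"
      proof -
        have "\<not> legendre c w < 0" using contra w by blast
        then show ?thesis by simp
      qed
      finally show ?thesis .
    qed
    \<comment> \<open>The bound holds for each w < 1 with N fixed; a finite sum is continuous, so w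
      may tend to 1 from the left.\<close>
    then have ev: "\<forall>\<^sub>F w in at_left 1. (\<Sum>n<N. - legendre_coeff c (Suc n) * w ^ Suc n) \<le> 1"
      using eventually_at_left_real[of 0 1] by (auto elim!: eventually_mono simp del: legendre_coeff.simps power_Suc)
    have "((\<lambda>w. \<Sum>n<N. - legendre_coeff c (Suc n) * w ^ Suc n) \<longlongrightarrow> (\<Sum>n<N. - legendre_coeff c (Suc n) * 1 ^ Suc n)) (at_left 1)"
      by (intro tendsto_intros)
    from tendsto_upperbound[OF this ev] show ?thesis by (simp del: legendre_coeff.simps)
  qed
  have "summable (\<lambda>n. c * (1 - c) * inverse (real (Suc n)))"
  proof (rule summableI_nonneg_bounded)
    show "0 \<le> c * (1 - c) * inverse (real (Suc n))" for n using c by simp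
    fix N
    have "(\<Sum>n<N. c * (1 - c) * inverse (real (Suc n))) \<le> (\<Sum>n<N. - legendre_coeff c (Suc n))"
      using legendre_coeff_lower_decay[OF c] by (intro sum_mono) (simp only: divide_inverse)
    then show "(\<Sum>n<N. c * (1 - c) * inverse (real (Suc n))) \<le> 1" using bd[of N] by linarith
  qed
  then have "summable (\<lambda>n. inverse (real (Suc n)))"
    using c by (subst (asm) summable_cmult_iff) auto
  then show False
    using not_summable_harmonic[where 'a = real] summable_Suc_iff[of "\<lambda>n. inverse (real n)"] by blast
qed

lemma legendre_zero:
  obtains w where "0 < w" "w < 1" "w \<noteq> 1 / 2" "legendre c w = 0"
proof -
  obtain v where v: "0 < v" "v < 1" "legendre c v < 0" using legendre_negative_value by blast
  have "legendre c 0 = 1" by (simp add: legendre_def)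
  moreover have "continuous_on {0..v} (legendre c)"
    by (rule continuous_at_imp_continuous_on) (use v in \<open>auto intro!: DERIV_isCont[OF legendre_DERIV]\<close>)
  ultimately obtain w where w: "0 \<le> w" "w \<le> v" "legendre c w = 0"
    using IVT2'[of "legendre c" v 0 0] v by auto
  have "w \<noteq> 0" using w \<open>legendre c 0 = 1\<close> by auto
  moreover have "w \<noteq> 1 / 2" using w(3) legendre_half_pos less_irrefl by metis
  ultimately show ?thesis using w v by (intro that[of w]) auto
qed

end

section \<open>Biradial functions\<close>

text \<open>Used to glue the derivatives of the solution from the two closed cones.\<close>

lemma has_derivative_within_Un:
  assumes "(f has_derivative f') (at x within S)" "(f has_derivative f') (at x within T)"
  shows "(f has_derivative f') (at x within S \<union> T)"
  using assms unfolding has_derivative_within Lim_within_Un by blast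

definition sqx :: "real^4 \<Rightarrow> real" where
  "sqx z = (z $ 1)\<^sup>2 + (z $ 2)\<^sup>2"

definition sqy :: "real^4 \<Rightarrow> real" where
  "sqy z = (z $ 3)\<^sup>2 + (z $ 4)\<^sup>2"

text \<open>The gradient at \<open>z\<close> of a function of \<open>sqx z\<close> and \<open>sqy z\<close> whose partial derivatives with
  respect to these two variables are \<open>p\<close> and \<open>q\<close>.\<close>

definition bgrad :: "real^4 \<Rightarrow> real \<Rightarrow> real \<Rightarrow> real^4" where
  "bgrad z p q = vector [2 * p * z $ 1, 2 * p * z $ 2, 2 * q * z $ 3, 2 * q * z $ 4]"

lemma bgrad_nth [simp]:
  "bgrad z p q $ 1 = 2 * p * z $ 1" "bgrad z p q $ 2 = 2 * p * z $ 2"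
  "bgrad z p q $ 3 = 2 * q * z $ 3" "bgrad z p q $ 4 = 2 * q * z $ 4"
  by (simp_all add: bgrad_def vector_def)

lemma inner_vec_4: "(u::real^4) \<bullet> v = u $ 1 * v $ 1 + u $ 2 * v $ 2 + u $ 3 * v $ 3 + u $ 4 * v $ 4"
  by (simp add: inner_vec_def sum_4)

lemma sq_nonneg [simp]: "0 \<le> sqx z" "0 \<le> sqy z"
  by (simp_all add: sqx_def sqy_def)

lemma sqx_plus_sqy: "sqx z + sqy z = (norm z)\<^sup>2"
  by (simp only: sqx_def sqy_def power2_norm_eq_inner inner_vec_4) (simp add: power2_eq_square)

lemma sq_sum_pos: "z \<noteq> 0 \<Longrightarrow> 0 < sqx z + sqy z"
  by (simp add: sqx_plus_sqy)

lemma sq_scaleR: "sqx (t *\<^sub>R z) = t\<^sup>2 * sqx z" "sqy (t *\<^sub>R z) = t\<^sup>2 * sqy z"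
  by (simp_all add: sqx_def sqy_def power_mult_distrib distrib_left)

lemma sq_zero [simp]: "sqx 0 = 0" "sqy 0 = 0"
  by (simp_all add: sqx_def sqy_def)

lemma continuous_on_sq: "continuous_on S sqx" "continuous_on S sqy"
  unfolding sqx_def[abs_def] sqy_def[abs_def] by (intro continuous_intros)+

lemma sq_has_derivative:
  "(sqx has_derivative (\<lambda>v. 2 * (z $ 1 * v $ 1 + z $ 2 * v $ 2))) (at z within S)"
  "(sqy has_derivative (\<lambda>v. 2 * (z $ 3 * v $ 3 + z $ 4 * v $ 4))) (at z within S)"
  unfolding sqx_def[abs_def] sqy_def[abs_def]
  by (rule derivative_eq_intros bounded_linear_imp_has_derivative[OF bounded_linear_vec_nth] refl | simp add: algebra_simps)+

lemma norm_x_part: "norm (x_part z) = sqrt (sqx z)"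
  by (simp add: x_part_def sqx_def norm_vec_def L2_set_def sum_2 vector_def)

lemma norm_y_part: "norm (y_part z) = sqrt (sqy z)"
  by (simp add: y_part_def sqy_def norm_vec_def L2_set_def sum_2 vector_def)

text \<open>Polar coordinates with a common radius in both planes exhibit the cone as the image of a
  three-dimensional space under a differentiable map.\<close>

lemma cone_negligible: "negligible {z. sqx z = sqy z}"
proof -
  define g :: "real \<times> real \<times> real \<Rightarrow> real^4" where
    "g p = (fst p * cos (fst (snd p))) *\<^sub>R axis 1 1 + (fst p * sin (fst (snd p))) *\<^sub>R axis 2 1
       + (fst p * cos (snd (snd p))) *\<^sub>R axis 3 1 + (fst p * sin (snd (snd p))) *\<^sub>R axis 4 1" for p
  have "g differentiable_on UNIV"
  proof -
    have "g differentiable (at p)" for p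
      unfolding g_def[abs_def] differentiable_def
      by (rule exI) (rule derivative_eq_intros refl)+
    then show ?thesis by (simp add: differentiable_on_def)
  qed
  then have "negligible (range g)"
    by (intro negligible_differentiable_image_lowdim) auto
  moreover have "z \<in> range g" if e: "sqx z = sqy z" for z
  proof -
    define \<rho> where "\<rho> = sqrt (sqx z)"
    have polar: "\<exists>t. u = \<rho> * cos t \<and> v = \<rho> * sin t" if "u\<^sup>2 + v\<^sup>2 = \<rho>\<^sup>2" for u v
    proof (cases "\<rho> = 0")
      case True
      then have "u = 0 \<and> v = 0" using that by (simp add: sum_power2_eq_zero_iff)
      then show ?thesis using True by auto
    next
      case False
      then have "(u / \<rho>)\<^sup>2 + (v / \<rho>)\<^sup>2 = 1" using that by (simp add: power_divide flip: add_divide_distrib)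
      then obtain t where "u / \<rho> = cos t" "v / \<rho> = sin t" using sincos_total_2pi by blast
      then show ?thesis using False by (intro exI[of _ t]) (auto simp: field_simps)
    qed
    have r2: "\<rho>\<^sup>2 = sqx z" by (simp add: \<rho>_def)
    obtain s where s: "z $ 1 = \<rho> * cos s" "z $ 2 = \<rho> * sin s"
      using polar[of "z $ 1" "z $ 2"] r2 by (auto simp: sqx_def)
    obtain t where t: "z $ 3 = \<rho> * cos t" "z $ 4 = \<rho> * sin t"
      using polar[of "z $ 3" "z $ 4"] r2 e by (auto simp: sqy_def)
    have "g (\<rho>, s, t) = z"
      by (simp add: g_def vec_eq_iff forall_4 axis_def s t)
    then show ?thesis by (metis rangeI)
  qed
  then have "{z. sqx z = sqy z} \<subseteq> range g" by blast
  ultimately show ?thesis by (rule negligible_subset)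
qed

lemma AE_off_cone: "AE z in lebesgue. sqx z \<noteq> sqy z"
  using cone_negligible by (intro AE_I'[of "{z. sqx z = sqy z}"]) (auto simp: negligible_iff_null_sets)

text \<open>Every homogeneous function of degree \<open>\<gamma>\<close> of \<open>(r, s)\<close> has this form. The functions \<open>profile_r\<close> and
  \<open>profile_s\<close> are its partial derivatives when \<open>\<kappa>'\<close> is the derivative of \<open>\<kappa>\<close>.\<close>

definition profile :: "real \<Rightarrow> real \<Rightarrow> real \<Rightarrow> (real \<Rightarrow> real) \<Rightarrow> real \<Rightarrow> real \<Rightarrow> real" where
  "profile a b \<gamma> \<kappa> r s = (b * r + a * s) powr \<gamma> * \<kappa> (a * s / (b * r + a * s))"

definition profile_r where
  "profile_r a b \<gamma> \<kappa> \<kappa>' r s = b * (b * r + a * s) powr (\<gamma> - 1) *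
     (\<gamma> * \<kappa> (a * s / (b * r + a * s)) - a * s / (b * r + a * s) * \<kappa>' (a * s / (b * r + a * s)))"

definition profile_s where
  "profile_s a b \<gamma> \<kappa> \<kappa>' r s = a * (b * r + a * s) powr (\<gamma> - 1) *
     (\<gamma> * \<kappa> (a * s / (b * r + a * s)) + (1 - a * s / (b * r + a * s)) * \<kappa>' (a * s / (b * r + a * s)))"

lemma profile_zero [simp]: "profile a b \<gamma> \<kappa> 0 0 = 0"
  by (simp add: profile_def)

text \<open>The arguments stand for squared radii, hence the doubled exponent; the quotient inside
  \<kappa> is invariant under scaling.\<close>

lemma profile_scale:
  assumes "t > 0"
  shows "profile a b \<gamma> \<kappa> (t\<^sup>2 * r) (t\<^sup>2 * s) = t powr (2 * \<gamma>) * profile a b \<gamma> \<kappa> r s"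
proof -
  have e: "b * (t\<^sup>2 * r) + a * (t\<^sup>2 * s) = t\<^sup>2 * (b * r + a * s)" by (simp add: algebra_simps)
  have w: "a * (t\<^sup>2 * s) / (t\<^sup>2 * (b * r + a * s)) = a * s / (b * r + a * s)"
    using assms by (simp add: mult.left_commute[of a])
  have "(t\<^sup>2 * (b * r + a * s)) powr \<gamma> = (t\<^sup>2) powr \<gamma> * (b * r + a * s) powr \<gamma>"
    by (rule powr_mult)
  also have "(t\<^sup>2) powr \<gamma> = t powr (2 * \<gamma>)"
    using assms powr_powr[of t 2 \<gamma>] by simp
  finally show ?thesis unfolding profile_def e w by (simp only: mult.assoc)
qed

lemma profile_has_derivative:
  fixes R S :: "'a::real_normed_vector \<Rightarrow> real"
  assumes R: "(R has_derivative R') (at z within X)" and S: "(S has_derivative S') (at z within X)"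
    and P: "b * R z + a * S z > 0"
    and \<kappa>: "DERIV \<kappa> (a * S z / (b * R z + a * S z)) :> \<kappa>' (a * S z / (b * R z + a * S z))"
  shows "((\<lambda>z. profile a b \<gamma> \<kappa> (R z) (S z)) has_derivative
    (\<lambda>v. profile_r a b \<gamma> \<kappa> \<kappa>' (R z) (S z) * R' v + profile_s a b \<gamma> \<kappa> \<kappa>' (R z) (S z) * S' v)) (at z within X)"
proof -
  define p where "p = b * R z + a * S z"
  define w where "w = a * S z / p"
  have p: "p > 0" using P by (simp add: p_def)
  have dP: "((\<lambda>z. b * R z + a * S z) has_derivative (\<lambda>v. b * R' v + a * S' v)) (at z within X)"
    by (intro has_derivative_add has_derivative_mult_right R S)
  have d1: "((\<lambda>z. (b * R z + a * S z) powr \<gamma>) has_derivative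
      (\<lambda>v. (b * R' v + a * S' v) * (\<gamma> * p powr (\<gamma> - 1)))) (at z within X)"
    by (rule DERIV_compose_FDERIV[OF _ dP]) (use p in \<open>auto simp: p_def intro: has_real_derivative_powr\<close>)
  have "((\<lambda>z. a * S z / (b * R z + a * S z)) has_derivative
      (\<lambda>v. (a * S' v * p - a * S z * (b * R' v + a * S' v)) / (p * p))) (at z within X)"
    using has_derivative_divide'[OF has_derivative_mult_right[OF S, of a] dP] p by (simp add: p_def)
  \<comment> \<open>In this form the derivatives of w in r and s are - w b / p and (1 - w) a / p, as
    they occur in \<open>profile_r\<close> and \<open>profile_s\<close>.\<close>
  then have dW: "((\<lambda>z. a * S z / (b * R z + a * S z)) has_derivative
      (\<lambda>v. (a * S' v - w * (b * R' v + a * S' v)) / p)) (at z within X)"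
    by (rule has_derivative_eq_rhs) (use p in \<open>auto simp: fun_eq_iff w_def field_simps\<close>)
  have d2: "((\<lambda>z. \<kappa> (a * S z / (b * R z + a * S z))) has_derivative
      (\<lambda>v. (a * S' v - w * (b * R' v + a * S' v)) / p * \<kappa>' w)) (at z within X)"
    by (rule DERIV_compose_FDERIV[OF _ dW]) (use \<kappa> in \<open>simp add: w_def p_def\<close>)
  have pp: "p powr \<gamma> = p * p powr (\<gamma> - 1)" using p by (simp add: powr_diff)
  show ?thesis
    unfolding profile_def
  proof (rule has_derivative_eq_rhs[OF has_derivative_mult[OF d1 d2]], rule ext)
    fix v
    show "(b * R z + a * S z) powr \<gamma> * ((a * S' v - w * (b * R' v + a * S' v)) / p * \<kappa>' w) +
         (b * R' v + a * S' v) * (\<gamma> * p powr (\<gamma> - 1)) * \<kappa> (a * S z / (b * R z + a * S z))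
       = profile_r a b \<gamma> \<kappa> \<kappa>' (R z) (S z) * R' v + profile_s a b \<gamma> \<kappa> \<kappa>' (R z) (S z) * S' v"
      unfolding profile_r_def profile_s_def p_def[symmetric] w_def[symmetric] pp
      using p by (simp add: field_simps)
  qed
qed

lemma profile_sqx_sqy_has_derivative:
  assumes "b * sqx z + a * sqy z > 0"
    "DERIV \<kappa> (a * sqy z / (b * sqx z + a * sqy z)) :> \<kappa>' (a * sqy z / (b * sqx z + a * sqy z))"
  shows "((\<lambda>z. profile a b \<gamma> \<kappa> (sqx z) (sqy z)) has_derivative
    (\<lambda>v. bgrad z (profile_r a b \<gamma> \<kappa> \<kappa>' (sqx z) (sqy z)) (profile_s a b \<gamma> \<kappa> \<kappa>' (sqx z) (sqy z)) \<bullet> v)) (at z)"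
  by (rule has_derivative_eq_rhs[OF profile_has_derivative[where R = sqx and S = sqy and z = z and X = UNIV and \<kappa>' = \<kappa>', OF sq_has_derivative assms]])
    (simp add: fun_eq_iff inner_vec_4 algebra_simps)

lemma profile_sqy_sqx_has_derivative:
  assumes "b * sqy z + a * sqx z > 0"
    "DERIV \<kappa> (a * sqx z / (b * sqy z + a * sqx z)) :> \<kappa>' (a * sqx z / (b * sqy z + a * sqx z))"
  shows "((\<lambda>z. profile a b \<gamma> \<kappa> (sqy z) (sqx z)) has_derivative
    (\<lambda>v. bgrad z (profile_s a b \<gamma> \<kappa> \<kappa>' (sqy z) (sqx z)) (profile_r a b \<gamma> \<kappa> \<kappa>' (sqy z) (sqx z)) \<bullet> v)) (at z)"
  by (rule has_derivative_eq_rhs[OF profile_has_derivative[where R = sqy and S = sqx and z = z and X = UNIV and \<kappa>' = \<kappa>', OF sq_has_derivative(2,1) assms]])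
    (simp add: fun_eq_iff inner_vec_4 algebra_simps)

text \<open>The lower bound on R keeps the base of the power away from 0. With a + b = 1 and S \<le>
  R the quotient stays in the compact interval up to a, on which \<kappa>' is bounded.\<close>

lemma bounded_lipschitz_profile:
  assumes R: "bounded_lipschitz K R" and S: "bounded_lipschitz K S"
    and bds: "\<And>z. z \<in> K \<Longrightarrow> 0 \<le> S z" "\<And>z. z \<in> K \<Longrightarrow> S z \<le> R z" "\<And>z. z \<in> K \<Longrightarrow> m \<le> R z" and m: "0 < m"
    and ab: "0 < a" "0 < b" "a + b = 1"
    and \<kappa>: "\<And>w. w \<in> {0..a} \<Longrightarrow> DERIV \<kappa> w :> \<kappa>' w" "continuous_on {0..a} \<kappa>'"
  shows "bounded_lipschitz K (\<lambda>z. profile a b \<gamma> \<kappa> (R z) (S z))"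
proof -
  have P: "bounded_lipschitz K (\<lambda>z. b * R z + a * S z)"
    by (intro bounded_lipschitz_add bounded_lipschitz_mult bounded_lipschitz_const R S)
  have Pm: "b * m \<le> b * R z + a * S z" if "z \<in> K" for z
  proof -
    have "b * m \<le> b * R z" "0 \<le> a * S z" using bds[OF that] ab by (auto intro: mult_left_mono)
    then show ?thesis by linarith
  qed
  have bm: "0 < b * m" using ab m by simp
  \<comment> \<open>Division is written as the power -1, so that the rule for powers
    applies.\<close>
  have "bounded_lipschitz K (\<lambda>z. a * S z * (b * R z + a * S z) powr (- 1))"
    by (intro bounded_lipschitz_mult bounded_lipschitz_const S bounded_lipschitz_powr[OF P Pm bm])
  moreover have "a * S z * (b * R z + a * S z) powr (- 1) = a * S z / (b * R z + a * S z)" if "z \<in> K" for z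
  proof -
    have "0 < b * R z + a * S z" using Pm[OF that] bm by linarith
    then show ?thesis by (simp add: powr_minus powr_one divide_inverse)
  qed
  ultimately have W: "bounded_lipschitz K (\<lambda>z. a * S z / (b * R z + a * S z))"
    by (rule bounded_lipschitz_cong)
  have W0: "a * S z / (b * R z + a * S z) \<in> {0..a}" if "z \<in> K" for z
  proof -
    have pos: "0 < b * R z + a * S z" using Pm[OF that] bm by linarith
    have "S z = b * S z + a * S z" using ab by (simp flip: distrib_right add: add.commute)
    also have "\<dots> \<le> b * R z + a * S z" using bds(2)[OF that] ab by simp
    finally have "a * S z \<le> a * (b * R z + a * S z)" using ab by simp
    then show ?thesis using pos ab bds(1)[OF that] by (simp add: pos_divide_le_eq)
  qed
  show ?thesis
    unfolding profile_def
    by (intro bounded_lipschitz_mult bounded_lipschitz_powr[OF P Pm bm] bounded_lipschitz_compose[OF W W0 \<kappa>])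
qed

lemma bounded_lipschitz_sq:
  assumes "K \<subseteq> cball 0 \<rho>"
  shows "bounded_lipschitz K sqx" "bounded_lipschitz K sqy"
  unfolding sqx_def[abs_def] sqy_def[abs_def] power2_eq_square
  by (intro bounded_lipschitz_add bounded_lipschitz_mult bounded_lipschitz_component[OF assms])+

section \<open>The two-phase solution\<close>

definition block_diag :: "real \<Rightarrow> real \<Rightarrow> real^4^4" where
  "block_diag p q = (\<chi> i j. if i = j then (if i = 1 \<or> i = 2 then p else q) else 0)"

lemma block_diag_mult: "(block_diag p q *v v) $ i = (if i = 1 \<or> i = 2 then p else q) * v $ i"
  using exhaust_4[of i] by (auto simp: block_diag_def matrix_vector_mult_def sum_4)

lemma block_diag_symmetric: "symmetric_matrix (block_diag p q)"
  by (simp add: symmetric_matrix_def block_diag_def transpose_def vec_eq_iff)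

lemma block_diag_elliptic:
  assumes "0 < p" "0 < q"
  shows "uniformly_elliptic (block_diag p q)"
proof -
  have e: "\<xi> \<bullet> (block_diag p q *v \<xi>) = p * sqx \<xi> + q * sqy \<xi>" for \<xi>
    by (simp add: inner_vec_4 block_diag_mult sqx_def sqy_def power2_eq_square algebra_simps)
  have m: "\<xi> \<bullet> ((l *\<^sub>R mat 1) *v \<xi>) = l * sqx \<xi> + l * sqy \<xi>" for l and \<xi> :: "real^4"
  proof -
    have "(l *\<^sub>R mat 1) *v \<xi> = l *\<^sub>R \<xi>"
      by (metis scaleR_matrix_vector_assoc matrix_vector_mul_lid)
    then show ?thesis
      by (simp add: inner_vec_4 sqx_def sqy_def power2_eq_square algebra_simps)
  qed
  have "min p q * sqx \<xi> + min p q * sqy \<xi> \<le> p * sqx \<xi> + q * sqy \<xi>" for \<xi>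
    by (intro add_mono mult_right_mono) auto
  moreover have "p * sqx \<xi> + q * sqy \<xi> \<le> max p q * sqx \<xi> + max p q * sqy \<xi>" for \<xi>
    by (intro add_mono mult_right_mono) auto
  ultimately show ?thesis
    unfolding uniformly_elliptic_def loewner_le_def e m
    using assms by (intro exI[of _ "min p q"] exI[of _ "max p q"]) auto
qed

text \<open>The entries (1, 1) and (3, 3) give p = c q and q = c p, so p^2 = q^2.\<close>

lemma block_diag_not_proportional:
  assumes "0 < p" "0 < q" "p \<noteq> q"
  shows "\<not> proportional (block_diag p q) (block_diag q p)"
proof
  assume "proportional (block_diag p q) (block_diag q p)"
  then obtain c where "block_diag p q = c *\<^sub>R block_diag q p \<or> block_diag q p = c *\<^sub>R block_diag p q"
    by (auto simp: proportional_def)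
  moreover have "block_diag p' q' $ 1 $ 1 = p'" "block_diag p' q' $ 3 $ 3 = q'" for p' q'
    by (simp_all add: block_diag_def)
  ultimately have "p = c * q \<and> q = c * p"
    by (metis real_scaleR_def vector_scaleR_component)
  then have "p * p = q * q" by (metis mult.assoc mult.commute)
  then have "p = q" using assms by (simp add: square_eq_iff)
  then show False using assms by simp
qed

text \<open>The normalisation a + b = 1 makes the argument of f equal to a on the cone, so that the
  zero of f at a becomes the free boundary.\<close>

locale cone_profile =
  fixes \<alpha> a b c :: real
  assumes c_eq: "c = \<alpha> * (\<alpha> + 1)" and \<alpha>: "0 < \<alpha>" "\<alpha> < 1 / 2" and ab: "0 < a" "0 < b" "a + b = 1"
    and zero: "legendre c a = 0"
begin

abbreviation "f \<equiv> legendre c"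
abbreviation "f1 \<equiv> legendre' c"
abbreviation "f2 \<equiv> legendre'' c"

definition "stream_const = - (a * b / (\<alpha> + 1))"
abbreviation "ur \<equiv> profile_r a b \<alpha> f f1"
abbreviation "us \<equiv> profile_s a b \<alpha> f f1"
definition "hh r s = stream_const * profile a b (\<alpha> - 1) f1 r s"
text \<open>Since \<open>f2\<close> is the derivative of \<open>f1\<close>, these are the partial
  derivatives of \<open>hh\<close>.\<close>

definition "hr r s = stream_const * profile_r a b (\<alpha> - 1) f1 f2 r s"
definition "hs r s = stream_const * profile_s a b (\<alpha> - 1) f1 f2 r s"

lemma c: "0 < c" "c < 1"
proof -
  show "0 < c" using \<alpha> by (simp add: c_eq)
  have "\<alpha> * (\<alpha> + 1) \<le> (1/2) * (3/2)" using \<alpha> by (intro mult_mono) auto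
  then show "c < 1" by (simp add: c_eq)
qed

lemma a_less_1: "a < 1" "b = 1 - a"
  using ab by auto

text \<open>With a + b = 1 one has s = b s + a s \<le> b r + a s. The bound by a < 1 keeps the
  argument inside the disc of convergence, and the strict version gives the sign of the
  solution.\<close>

lemma weight_range:
  assumes "0 \<le> s" "s \<le> r" "0 < r"
  shows "0 < b * r + a * s" "0 \<le> a * s / (b * r + a * s)" "a * s / (b * r + a * s) \<le> a"
    "\<bar>a * s / (b * r + a * s)\<bar> < 1" "s < r \<Longrightarrow> a * s / (b * r + a * s) < a"
proof -
  have "0 < b * r" "0 \<le> a * s" using assms ab by auto
  then show P: "0 < b * r + a * s" by linarith
  have split: "s = b * s + a * s" using ab by (simp flip: distrib_right add: add.commute)
  have "b * s \<le> b * r" using assms ab by simp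
  then have "s \<le> b * r + a * s" using split by linarith
  then show le: "a * s / (b * r + a * s) \<le> a" using P ab by (simp add: pos_divide_le_eq)
  show ge: "0 \<le> a * s / (b * r + a * s)" using P assms ab by simp
  show "\<bar>a * s / (b * r + a * s)\<bar> < 1" using le ge a_less_1 by linarith
  show "a * s / (b * r + a * s) < a" if "s < r"
  proof -
    have "b * s < b * r" using that ab by simp
    then have "s < b * r + a * s" using split by linarith
    then show ?thesis using P ab by (simp add: pos_divide_less_eq)
  qed
qed

lemma profile_f_diag: "profile a b \<alpha> f r r = 0"
proof (cases "r = 0")
  case False
  then have "a * r / (b * r + a * r) = a" using ab by (simp flip: distrib_right add: add.commute)
  then show ?thesis by (simp add: profile_def zero)
qed simp

lemma profile_f_pos:
  assumes "0 \<le> s" "s < r"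
  shows "0 < profile a b \<alpha> f r s"
proof -
  note w = weight_range[of s r]
  have "f a < f (a * s / (b * r + a * s))"
    using w assms a_less_1 by (intro legendre_strict_decreasing c) auto
  then show ?thesis using w(1) assms zero by (simp add: profile_def)
qed

text \<open>In the variables \<open>r\<close> and \<open>s\<close> the function \<open>hh\<close> is \<open>(a ur - b us) / (\<alpha> + 1)\<close>, where the terms with \<open>f\<close> itself
  cancel. The two identities are equivalent to the Legendre equation.\<close>

lemma stream_identities:
  assumes "0 \<le> s" "s \<le> r" "0 < r"
  shows "hh r s + s * hs r s = a * ur r s" "hh r s + r * hr r s = - b * us r s"
proof -
  note w = weight_range[OF assms]
  define p where "p = b * r + a * s"
  define w where "w = a * s / p"
  define x where "x = p powr (\<alpha> - 1 - 1)"
  have p: "p > 0" using w(1) by (simp add: p_def)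
  have px: "p powr (\<alpha> - 1) = p * x" using powr_mult_base[of p "\<alpha> - 1 - 1"] p by (simp add: x_def)
  \<comment> \<open>Replacing r and s by p and w makes each term \<open>stream_const\<close> times p
    x times an expression in w alone.\<close>
  have sa: "a * s = w * p" using p by (simp add: w_def)
  have rb: "b * r = (1 - w) * p" 
  proof -
    have "b * r = p - a * s" by (simp add: p_def)
    then show ?thesis unfolding sa by (simp add: algebra_simps)
  qed
  have ode: "w * (1 - w) * f2 w = - (1 - 2 * w) * f1 w - \<alpha> * (\<alpha> + 1) * f w"
  proof -
    have "w * (1 - w) * f2 w + (1 - 2 * w) * f1 w + c * f w = 0"
      using w(4) by (intro legendre_ODE c) (simp add: w_def p_def)
    moreover have "c * f w = \<alpha> * (\<alpha> + 1) * f w" by (simp only: c_eq)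
    ultimately show ?thesis by linarith
  qed
  have "s * hs r s = stream_const * (a * s) * x * ((\<alpha> - 1) * f1 w + (1 - w) * f2 w)"
    by (simp add: hs_def profile_s_def x_def w_def p_def mult_ac)
  also have "\<dots> = stream_const * (p * x) * (w * (\<alpha> - 1) * f1 w + w * (1 - w) * f2 w)"
    unfolding sa by (simp add: algebra_simps)
  finally have 1: "s * hs r s = stream_const * (p * x) * (w * (\<alpha> - 1) * f1 w + w * (1 - w) * f2 w)" .
  have "r * hr r s = stream_const * (b * r) * x * ((\<alpha> - 1) * f1 w - w * f2 w)"
    by (simp add: hr_def profile_r_def x_def w_def p_def mult_ac)
  also have "\<dots> = stream_const * (p * x) * ((1 - w) * (\<alpha> - 1) * f1 w - w * (1 - w) * f2 w)"
    unfolding rb by (simp add: algebra_simps)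
  finally have 2: "r * hr r s = stream_const * (p * x) * ((1 - w) * (\<alpha> - 1) * f1 w - w * (1 - w) * f2 w)" .
  have 3: "hh r s = stream_const * (p * x) * f1 w"
    unfolding hh_def profile_def p_def[symmetric] w_def[symmetric] px by (simp only: mult.assoc)
  have sc: "stream_const * (\<alpha> + 1) = - (a * b)" using \<alpha> by (simp add: stream_const_def)
  \<comment> \<open>After the second derivative is eliminated by the Legendre equation, a factor
    \<alpha> + 1 splits off and cancels the denominator of \<open>stream_const\<close>.\<close>
  have "hh r s + s * hs r s = stream_const * (p * x) * ((\<alpha> + 1) * (w * f1 w - \<alpha> * f w))"
    unfolding 1 3 ode by (simp add: algebra_simps)
  also have "\<dots> = (stream_const * (\<alpha> + 1)) * ((p * x) * (w * f1 w - \<alpha> * f w))" by (simp only: mult_ac)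
  also have "\<dots> = a * ur r s"
    unfolding sc profile_r_def p_def[symmetric] w_def[symmetric] px by (simp add: algebra_simps)
  finally show "hh r s + s * hs r s = a * ur r s" .
  have "hh r s + r * hr r s = stream_const * (p * x) * ((\<alpha> + 1) * ((1 - w) * f1 w + \<alpha> * f w))"
    unfolding 2 3 ode by (simp add: algebra_simps)
  also have "\<dots> = (stream_const * (\<alpha> + 1)) * ((p * x) * ((1 - w) * f1 w + \<alpha> * f w))" by (simp only: mult_ac)
  also have "\<dots> = - b * us r s"
    unfolding sc profile_s_def p_def[symmetric] w_def[symmetric] px by (simp add: algebra_simps)
  finally show "hh r s + r * hr r s = - b * us r s" .
qed

text \<open>Since f(a) = 0, only f' survives on both sides, with the factors - b a and a (1 - a);
  here b = 1 - a.\<close>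

lemma gradient_match:
  assumes "0 < r"
  shows "ur r r = - us r r"
proof -
  have "a * r / (b * r + a * r) = a" using ab assms by (simp flip: distrib_right add: add.commute)
  then show ?thesis by (simp add: profile_r_def profile_s_def zero a_less_1(2))
qed

section \<open>The solution, the potential, and their classical gradients off the cone\<close>

definition qp :: "real^4 \<Rightarrow> real" where
  "qp z = profile a b \<alpha> f (max (sqx z) (sqy z)) (sqy z)"

definition qm :: "real^4 \<Rightarrow> real" where
  "qm z = profile a b \<alpha> f (max (sqx z) (sqy z)) (sqx z)"

definition q :: "real^4 \<Rightarrow> real" where
  "q z = qp z - qm z"

text \<open>Maximum and minimum make the function symmetric in x and y, hence continuous across the
  cone away from the origin.\<close>

definition h :: "real^4 \<Rightarrow> real" where
  "h z = hh (max (sqx z) (sqy z)) (min (sqx z) (sqy z))"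

definition grad_qp :: "real^4 \<Rightarrow> real^4" where
  "grad_qp z = (if sqy z < sqx z then bgrad z (ur (sqx z) (sqy z)) (us (sqx z) (sqy z)) else 0)"

definition grad_qm :: "real^4 \<Rightarrow> real^4" where
  "grad_qm z = (if sqx z < sqy z then bgrad z (us (sqy z) (sqx z)) (ur (sqy z) (sqx z)) else 0)"

text \<open>The branch used on the cone itself is arbitrary, as the cone is negligible and the
  derivative is only claimed off it.\<close>

definition grad_h :: "real^4 \<Rightarrow> real^4" where
  "grad_h z = (if sqy z < sqx z then bgrad z (hr (sqx z) (sqy z)) (hs (sqx z) (sqy z))
     else bgrad z (hs (sqy z) (sqx z)) (hr (sqy z) (sqx z)))"

lemma open_sq_less: "open {z. sqy z < sqx z}" "open {z. sqx z < sqy z}"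
  by (intro open_Collect_less continuous_on_sq)+

text \<open>The maximum in \<open>qp\<close> replaces a case distinction: where |x| \<le> |y| both
  arguments of the profile coincide, and the profile vanishes on the diagonal.\<close>

lemma qp_eq: "sqy z \<le> sqx z \<Longrightarrow> qp z = profile a b \<alpha> f (sqx z) (sqy z)" "sqx z \<le> sqy z \<Longrightarrow> qp z = 0"
  by (simp_all add: qp_def max_def profile_f_diag)

lemma qm_eq: "sqx z \<le> sqy z \<Longrightarrow> qm z = profile a b \<alpha> f (sqy z) (sqx z)" "sqy z \<le> sqx z \<Longrightarrow> qm z = 0"
  by (auto simp add: qm_def max_def profile_f_diag)

text \<open>The argument of f is at most a < 1 up to and including the cone, so each formula is
  differentiable there in the full sense; this is what makes the gluing on the cone
  possible.\<close>

lemma profile_f_has_derivative: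
  shows "sqy z \<le> sqx z \<Longrightarrow> 0 < sqx z \<Longrightarrow> ((\<lambda>z. profile a b \<alpha> f (sqx z) (sqy z)) has_derivative
      (\<lambda>v. bgrad z (ur (sqx z) (sqy z)) (us (sqx z) (sqy z)) \<bullet> v)) (at z)"
    and "sqx z \<le> sqy z \<Longrightarrow> 0 < sqy z \<Longrightarrow> ((\<lambda>z. profile a b \<alpha> f (sqy z) (sqx z)) has_derivative
      (\<lambda>v. bgrad z (us (sqy z) (sqx z)) (ur (sqy z) (sqx z)) \<bullet> v)) (at z)"
  using weight_range[of "sqy z" "sqx z"] weight_range[of "sqx z" "sqy z"]
  by (auto intro!: profile_sqx_sqy_has_derivative profile_sqy_sqx_has_derivative legendre_DERIV c)

lemma qp_has_derivative:
  assumes "sqx z \<noteq> sqy z"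
  shows "(qp has_derivative (\<lambda>v. grad_qp z \<bullet> v)) (at z)"
proof (cases "sqy z < sqx z")
  case True
  then have "0 < sqx z" using sq_nonneg(2)[of z] by linarith
  with True have "((\<lambda>z. profile a b \<alpha> f (sqx z) (sqy z)) has_derivative (\<lambda>v. grad_qp z \<bullet> v)) (at z)"
    using profile_f_has_derivative(1)[of z] by (simp add: grad_qp_def)
  then show ?thesis
    by (rule has_derivative_transform_within_open[OF _ open_sq_less(1)]) (use True qp_eq(1) in auto)
next
  case False
  have "((\<lambda>z. 0) has_derivative (\<lambda>v. grad_qp z \<bullet> v)) (at z)" using False by (simp add: grad_qp_def)
  then show ?thesis
    by (rule has_derivative_transform_within_open[OF _ open_sq_less(2)]) (use False assms qp_eq(2) in auto)
qed

lemma qm_has_derivative: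
  assumes "sqx z \<noteq> sqy z"
  shows "(qm has_derivative (\<lambda>v. grad_qm z \<bullet> v)) (at z)"
proof (cases "sqx z < sqy z")
  case True
  then have "0 < sqy z" using sq_nonneg(1)[of z] by linarith
  with True have "((\<lambda>z. profile a b \<alpha> f (sqy z) (sqx z)) has_derivative (\<lambda>v. grad_qm z \<bullet> v)) (at z)"
    using profile_f_has_derivative(2)[of z] by (simp add: grad_qm_def)
  then show ?thesis
    by (rule has_derivative_transform_within_open[OF _ open_sq_less(2)]) (use True qm_eq(1) in auto)
next
  case False
  have "((\<lambda>z. 0) has_derivative (\<lambda>v. grad_qm z \<bullet> v)) (at z)" using False by (simp add: grad_qm_def)
  then show ?thesis
    by (rule has_derivative_transform_within_open[OF _ open_sq_less(1)]) (use False assms qm_eq(2) in auto)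
qed

lemma bgrad_scale: "bgrad z (k * p) (k * r) = k *\<^sub>R bgrad z p r"
  by (simp add: vec_eq_iff forall_4)

lemma h_has_derivative:
  assumes "sqx z \<noteq> sqy z"
  shows "(h has_derivative (\<lambda>v. grad_h z \<bullet> v)) (at z)"
proof (cases "sqy z < sqx z")
  case True
  then have pos: "0 < sqx z" using sq_nonneg(2)[of z] by linarith
  note w = weight_range[of "sqy z" "sqx z"]
  have "((\<lambda>z. profile a b (\<alpha> - 1) f1 (sqx z) (sqy z)) has_derivative
     (\<lambda>v. bgrad z (profile_r a b (\<alpha> - 1) f1 f2 (sqx z) (sqy z)) (profile_s a b (\<alpha> - 1) f1 f2 (sqx z) (sqy z)) \<bullet> v)) (at z)"
    using w pos True by (intro profile_sqx_sqy_has_derivative legendre'_DERIV c) auto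
  from has_derivative_mult_right[OF this, of stream_const]
  have "((\<lambda>z. hh (sqx z) (sqy z)) has_derivative (\<lambda>v. grad_h z \<bullet> v)) (at z)"
    using True by (simp add: grad_h_def hh_def hr_def hs_def bgrad_scale)
  then show ?thesis
    by (rule has_derivative_transform_within_open[OF _ open_sq_less(1)]) (use True in \<open>auto simp: h_def\<close>)
next
  case False
  then have lt: "sqx z < sqy z" using assms by simp
  then have pos: "0 < sqy z" using sq_nonneg(1)[of z] by linarith
  note w = weight_range[of "sqx z" "sqy z"]
  have "((\<lambda>z. profile a b (\<alpha> - 1) f1 (sqy z) (sqx z)) has_derivative
     (\<lambda>v. bgrad z (profile_s a b (\<alpha> - 1) f1 f2 (sqy z) (sqx z)) (profile_r a b (\<alpha> - 1) f1 f2 (sqy z) (sqx z)) \<bullet> v)) (at z)"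
    using w pos lt by (intro profile_sqy_sqx_has_derivative legendre'_DERIV c) auto
  from has_derivative_mult_right[OF this, of stream_const]
  have "((\<lambda>z. hh (sqy z) (sqx z)) has_derivative (\<lambda>v. grad_h z \<bullet> v)) (at z)"
    using False by (simp add: grad_h_def hh_def hr_def hs_def bgrad_scale)
  then show ?thesis
    by (rule has_derivative_transform_within_open[OF _ open_sq_less(2)]) (use lt in \<open>auto simp: h_def\<close>)
qed

text \<open>The flux is the row-wise divergence of the antisymmetric matrix field with the entries
  \<open>pot i j\<close> for \<open>i \<in> {1, 2}\<close> and \<open>j \<in> {3, 4}\<close>, and zero diagonal blocks.\<close>

definition pot :: "4 \<Rightarrow> 4 \<Rightarrow> real^4 \<Rightarrow> real" where
  "pot i j z = h z * (z $ i * z $ j)"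

definition grad_pot :: "4 \<Rightarrow> 4 \<Rightarrow> real^4 \<Rightarrow> real^4" where
  "grad_pot i j z = (z $ i * z $ j) *\<^sub>R grad_h z + (h z * z $ j) *\<^sub>R axis i 1 + (h z * z $ i) *\<^sub>R axis j 1"

lemma pot_has_derivative:
  assumes "sqx z \<noteq> sqy z"
  shows "(pot i j has_derivative (\<lambda>v. grad_pot i j z \<bullet> v)) (at z)"
proof -
  have nth: "((\<lambda>z. z $ k) has_derivative (\<lambda>v. v $ k)) (at z)" for k and z :: "real^4"
    by (rule bounded_linear_imp_has_derivative[OF bounded_linear_vec_nth])
  show ?thesis
    unfolding pot_def[abs_def]
    by (rule has_derivative_eq_rhs[OF has_derivative_mult[OF h_has_derivative[OF assms]
            has_derivative_mult[OF nth nth]]])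
      (simp add: fun_eq_iff grad_pot_def inner_add_left inner_axis' algebra_simps)
qed

text \<open>Summing the derivatives of the entries over one plane produces the left-hand sides of
  \<open>stream_identities\<close>. In the second cone the radii exchange roles, and the minus sign
  in front of the second matrix accounts for the opposite sign.\<close>

lemma flux_eq:
  assumes "sqx z \<noteq> sqy z"
  defines "F \<equiv> block_diag a b *v grad_qp z - block_diag b a *v grad_qm z"
  shows "F $ 1 = grad_pot 1 3 z $ 3 + grad_pot 1 4 z $ 4"
    "F $ 2 = grad_pot 2 3 z $ 3 + grad_pot 2 4 z $ 4"
    "F $ 3 = - (grad_pot 1 3 z $ 1 + grad_pot 2 3 z $ 2)"
    "F $ 4 = - (grad_pot 1 4 z $ 1 + grad_pot 2 4 z $ 2)"
proof -
  have ax: "axis i (1::real) $ j = (if i = j then 1 else 0)" for i j :: 4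
    by (simp add: axis_def)
  have "F $ 1 = grad_pot 1 3 z $ 3 + grad_pot 1 4 z $ 4 \<and>
    F $ 2 = grad_pot 2 3 z $ 3 + grad_pot 2 4 z $ 4 \<and>
    F $ 3 = - (grad_pot 1 3 z $ 1 + grad_pot 2 3 z $ 2) \<and>
    F $ 4 = - (grad_pot 1 4 z $ 1 + grad_pot 2 4 z $ 2)"
  proof (cases "sqy z < sqx z")
    case True
    then have pos: "0 < sqx z" using sq_nonneg(2)[of z] by linarith
    note I = stream_identities[OF sq_nonneg(2) less_imp_le[OF True] pos]
    have hz: "h z = hh (sqx z) (sqy z)" using True by (simp add: h_def)
    \<comment> \<open>Each of the two derivatives contributes one h, because the plane has dimension
      two, and the squares of the coordinates add up to \<open>sqy z\<close>.\<close>
    have e1: "grad_pot i 3 z $ 3 + grad_pot i 4 z $ 4 = 2 * z $ i * (h z + sqy z * hs (sqx z) (sqy z))"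
      if "i = 1 \<or> i = 2" for i
      using True that by (auto simp: grad_pot_def grad_h_def ax sqy_def power2_eq_square algebra_simps)
    have e2: "grad_pot 1 j z $ 1 + grad_pot 2 j z $ 2 = 2 * z $ j * (h z + sqx z * hr (sqx z) (sqy z))"
      if "j = 3 \<or> j = 4" for j
      using True that by (auto simp: grad_pot_def grad_h_def ax sqx_def power2_eq_square algebra_simps)
    have Fi: "F $ i = (if i = 1 \<or> i = 2 then a else b) * bgrad z (ur (sqx z) (sqy z)) (us (sqx z) (sqy z)) $ i" for i
      using True by (simp add: F_def block_diag_mult grad_qp_def grad_qm_def)
    show ?thesis unfolding Fi using e1[of 1] e1[of 2] e2[of 3] e2[of 4] unfolding hz I
      by (simp add: algebra_simps)
  next
    case False
    then have lt: "sqx z < sqy z" using assms by simp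
    then have pos: "0 < sqy z" using sq_nonneg(1)[of z] by linarith
    note I = stream_identities[OF sq_nonneg(1) less_imp_le[OF lt] pos]
    have hz: "h z = hh (sqy z) (sqx z)" using lt by (simp add: h_def)
    have e1: "grad_pot i 3 z $ 3 + grad_pot i 4 z $ 4 = 2 * z $ i * (h z + sqy z * hr (sqy z) (sqx z))"
      if "i = 1 \<or> i = 2" for i
      using False that by (auto simp: grad_pot_def grad_h_def ax sqy_def power2_eq_square algebra_simps)
    have e2: "grad_pot 1 j z $ 1 + grad_pot 2 j z $ 2 = 2 * z $ j * (h z + sqx z * hs (sqy z) (sqx z))"
      if "j = 3 \<or> j = 4" for j
      using False that by (auto simp: grad_pot_def grad_h_def ax sqx_def power2_eq_square algebra_simps)
    have Fi: "F $ i = - ((if i = 1 \<or> i = 2 then b else a) * bgrad z (us (sqy z) (sqx z)) (ur (sqy z) (sqx z)) $ i)" for i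
      using lt by (simp add: F_def block_diag_mult grad_qp_def grad_qm_def)
    show ?thesis unfolding Fi using e1[of 1] e1[of 2] e2[of 3] e2[of 4] unfolding hz I
      by (simp add: algebra_simps)
  qed
  then show "F $ 1 = grad_pot 1 3 z $ 3 + grad_pot 1 4 z $ 4"
    "F $ 2 = grad_pot 2 3 z $ 3 + grad_pot 2 4 z $ 4"
    "F $ 3 = - (grad_pot 1 3 z $ 1 + grad_pot 2 3 z $ 2)"
    "F $ 4 = - (grad_pot 1 4 z $ 1 + grad_pot 2 4 z $ 2)" by blast+
qed

section \<open>Homogeneity and Lipschitz bounds, from estimates on an annulus\<close>

lemma max_sq_lower:
  assumes "1 / 2 \<le> norm z"
  shows "1 / 8 \<le> max (sqx z) (sqy z)"
proof -
  have "(1 / 2)\<^sup>2 \<le> (norm z)\<^sup>2" using assms by (intro power_mono) auto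
  then have "1 / 4 \<le> sqx z + sqy z" by (simp add: sqx_plus_sqy power2_eq_square)
  then show ?thesis by linarith
qed

lemma max_scale: "max (t\<^sup>2 * x) (t\<^sup>2 * y) = t\<^sup>2 * max x (y::real)"
  "min (t\<^sup>2 * x) (t\<^sup>2 * y) = t\<^sup>2 * min x (y::real)"
  by (simp_all add: max_mult_distrib_left min_mult_distrib_left)

lemma annulus_lipschitz:
  defines "K \<equiv> {z::real^4. 1/2 \<le> norm z \<and> norm z \<le> 1}"
  shows "bounded_lipschitz K (\<lambda>z. z $ i)" "bounded_lipschitz K sqx" "bounded_lipschitz K sqy"
    "bounded_lipschitz K (\<lambda>z. max (sqx z) (sqy z))" "bounded_lipschitz K (\<lambda>z. min (sqx z) (sqy z))"
proof -
  have K: "K \<subseteq> cball 0 1" by (auto simp: K_def)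
  show "bounded_lipschitz K (\<lambda>z. z $ i)" by (rule bounded_lipschitz_component[OF K])
  show s: "bounded_lipschitz K sqx" "bounded_lipschitz K sqy" by (rule bounded_lipschitz_sq[OF K])+
  show m: "bounded_lipschitz K (\<lambda>z. max (sqx z) (sqy z))" by (rule bounded_lipschitz_max[OF s])
  \<comment> \<open>The minimum is the sum minus the maximum.\<close>
  have "bounded_lipschitz K (\<lambda>z. sqx z + sqy z + (-1) * max (sqx z) (sqy z))"
    by (intro bounded_lipschitz_add bounded_lipschitz_mult bounded_lipschitz_const s m)
  then show "bounded_lipschitz K (\<lambda>z. min (sqx z) (sqy z))"
    by (rule bounded_lipschitz_cong) (simp add: max_def min_def)
qed

lemma f_DERIV: "w \<in> {0..a} \<Longrightarrow> DERIV f w :> f1 w" "w \<in> {0..a} \<Longrightarrow> DERIV f1 w :> f2 w"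
  using a_less_1 by (auto intro!: legendre_DERIV legendre'_DERIV c)

lemma f_continuous: "continuous_on {0..a} f" "continuous_on {0..a} f1" "continuous_on {0..a} f2"
proof -
  show "continuous_on {0..a} f" by (intro continuous_at_imp_continuous_on ballI DERIV_isCont[OF f_DERIV(1)])
  show "continuous_on {0..a} f1" by (intro continuous_at_imp_continuous_on ballI DERIV_isCont[OF f_DERIV(2)])
  show "continuous_on {0..a} f2"
    using a_less_1 by (intro continuous_at_imp_continuous_on ballI legendre''_isCont c) auto
qed

lemma two_alpha: "0 < 2 * \<alpha>" "2 * \<alpha> < 1"
  using \<alpha> by auto

lemma qp_homogeneous: "homogeneous (2 * \<alpha>) qp"
  by (simp add: homogeneous_def qp_def sq_scaleR max_scale profile_scale)

lemma qm_homogeneous: "homogeneous (2 * \<alpha>) qm"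
  by (simp add: homogeneous_def qm_def sq_scaleR max_scale profile_scale)

text \<open>The quadratic factor raises the negative degree 2 (\<alpha> - 1) of h to 2 \<alpha>, so
  the entries satisfy the same kind of estimates as the solution.\<close>

lemma pot_homogeneous: "homogeneous (2 * \<alpha>) (pot i j)"
  unfolding homogeneous_def
proof (intro allI impI)
  fix t :: real and z :: "real^4" assume t: "t > 0"
  have e: "t powr (2 * (\<alpha> - 1)) * (t * t) = t powr (2 * \<alpha>)"
    using t by (simp add: right_diff_distrib powr_diff power2_eq_square)
  have "pot i j (t *\<^sub>R z) = (t powr (2 * (\<alpha> - 1)) * (t * t)) * pot i j z"
    unfolding pot_def h_def hh_def sq_scaleR max_scale profile_scale[OF t] vector_scaleR_component real_scaleR_def
    by (simp only: mult_ac)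
  then show "pot i j (t *\<^sub>R z) = t powr (2 * \<alpha>) * pot i j z" by (simp only: e)
qed

lemma qp_homogeneous_lipschitz: "\<exists>C. homogeneous_lipschitz (2 * \<alpha>) C qp"
proof (rule homogeneous_lipschitz_from_annulus[OF two_alpha qp_homogeneous])
  show "bounded_lipschitz {z. 1 / 2 \<le> norm z \<and> norm z \<le> 1} qp"
    unfolding qp_def[abs_def]
    by (rule bounded_lipschitz_profile[OF annulus_lipschitz(4) annulus_lipschitz(3), of "1/8" a b f f1])
      (use ab f_DERIV f_continuous max_sq_lower in auto)
qed (simp add: qp_def)

lemma qm_homogeneous_lipschitz: "\<exists>C. homogeneous_lipschitz (2 * \<alpha>) C qm"
proof (rule homogeneous_lipschitz_from_annulus[OF two_alpha qm_homogeneous])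
  show "bounded_lipschitz {z. 1 / 2 \<le> norm z \<and> norm z \<le> 1} qm"
    unfolding qm_def[abs_def]
    by (rule bounded_lipschitz_profile[OF annulus_lipschitz(4) annulus_lipschitz(2), of "1/8" a b f f1])
      (use ab f_DERIV f_continuous max_sq_lower in auto)
qed (simp add: qm_def)

lemma pot_homogeneous_lipschitz: "\<exists>C. homogeneous_lipschitz (2 * \<alpha>) C (pot i j)"
proof (rule homogeneous_lipschitz_from_annulus[OF two_alpha pot_homogeneous])
  have "bounded_lipschitz {z. 1 / 2 \<le> norm z \<and> norm z \<le> 1}
      (\<lambda>z. profile a b (\<alpha> - 1) f1 (max (sqx z) (sqy z)) (min (sqx z) (sqy z)))"
    by (rule bounded_lipschitz_profile[OF annulus_lipschitz(4) annulus_lipschitz(5), of "1/8" a b f1 f2])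
      (use ab f_DERIV f_continuous max_sq_lower in \<open>auto simp: min_le_iff_disj le_max_iff_disj\<close>)
  then show "bounded_lipschitz {z. 1 / 2 \<le> norm z \<and> norm z \<le> 1} (pot i j)"
    unfolding pot_def[abs_def] h_def hh_def
    by (intro bounded_lipschitz_mult bounded_lipschitz_const annulus_lipschitz(1))
qed (simp add: pot_def)

lemma q_homogeneous_lipschitz: "\<exists>C. homogeneous_lipschitz (2 * \<alpha>) C q"
  unfolding q_def[abs_def] using qp_homogeneous_lipschitz qm_homogeneous_lipschitz homogeneous_lipschitz_diff by blast

section \<open>Weak gradients and the weak equation\<close>

lemma four_gt: "2 - 2 * (2 * \<alpha>) < real CARD(4)"
  using \<alpha> by simp

text \<open>A kink along the cone is harmless: the Lipschitz estimate holds across it, and the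
  classical gradient is needed only almost everywhere.\<close>

lemma weak_gradient_off_cone:
  assumes u: "\<exists>C. homogeneous_lipschitz (2 * \<alpha>) C u"
    and D: "\<And>z. sqx z \<noteq> sqy z \<Longrightarrow> (u has_derivative (\<lambda>v. g z \<bullet> v)) (at z)"
  shows "has_weak_gradient u g" "L2_loc u" "L2_loc g"
proof -
  obtain C where C: "homogeneous_lipschitz (2 * \<alpha>) C u" using u by blast
  have "AE z in lebesgue. (u has_derivative (\<lambda>v. g z \<bullet> v)) (at z)"
    using AE_off_cone by (rule eventually_mono) (rule D)
  from homogeneous_lipschitz_weak_gradient[OF C two_alpha four_gt this]
  show "has_weak_gradient u g" "L2_loc u" "L2_loc g" .
qed

lemmas qp_weak_gradient = weak_gradient_off_cone(1)[OF qp_homogeneous_lipschitz qp_has_derivative]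
lemmas qm_weak_gradient = weak_gradient_off_cone(1)[OF qm_homogeneous_lipschitz qm_has_derivative]
lemmas pot_weak_gradient = weak_gradient_off_cone(1)[OF pot_homogeneous_lipschitz pot_has_derivative]

lemma q_W12: "W12_loc q"
proof -
  have "(q has_derivative (\<lambda>v. (grad_qp z - grad_qm z) \<bullet> v)) (at z)" if "sqx z \<noteq> sqy z" for z
    unfolding q_def[abs_def] inner_diff_left
    by (rule has_derivative_diff[OF qp_has_derivative[OF that] qm_has_derivative[OF that]])
  from weak_gradient_off_cone[OF q_homogeneous_lipschitz this]
  show ?thesis unfolding W12_loc_def by blast
qed

text \<open>The pairing with the gradient of \<phi> splits into one antisymmetric pair of terms for
  each entry of the potential, and each pair integrates to zero by
  \<open>weak_gradient_curl_free\<close>.\<close>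

lemma distributional_div_zero_flux:
  "distributional_div_zero (\<lambda>z. block_diag a b *v grad_qp z - block_diag b a *v grad_qm z)"
  unfolding distributional_div_zero_def
proof (intro conjI allI impI)
  show "L1_loc (\<lambda>z. block_diag a b *v grad_qp z - block_diag b a *v grad_qm z)"
    using qp_weak_gradient qm_weak_gradient by (intro L1_loc_matrix_diff) (auto simp: has_weak_gradient_def)
  fix \<phi> :: "real^4 \<Rightarrow> real" assume \<phi>: "test_function \<phi>"
  define I where "I i j z = grad_pot i j z $ j * partial_deriv i \<phi> z - grad_pot i j z $ i * partial_deriv j \<phi> z" for i j z
  have L1: "L1_loc (grad_pot i j)" for i j using pot_weak_gradient by (simp add: has_weak_gradient_def)
  have int: "integrable lebesgue (\<lambda>z. grad_pot i j z $ k * partial_deriv l \<phi> z)" for i j k l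
    by (rule test_function_integrable_mult[OF L1 test_function_partial_deriv[OF \<phi>]])
  have I_int: "integrable lebesgue (I i j)" for i j
    unfolding I_def[abs_def] by (intro Bochner_Integration.integrable_diff int)
  have I0: "integral\<^sup>L lebesgue (I i j) = 0" for i j
    unfolding I_def[abs_def] Bochner_Integration.integral_diff[OF int int]
    using weak_gradient_curl_free[OF pot_weak_gradient \<phi>, of i j j i] by simp
  have ae: "AE z in lebesgue. (block_diag a b *v grad_qp z - block_diag b a *v grad_qm z) \<bullet> gradient \<phi> z
      = I 1 3 z + I 1 4 z + I 2 3 z + I 2 4 z"
    using AE_off_cone
  proof eventually_elim
    case (elim z)
    show ?case
      unfolding inner_vec_4 flux_eq[OF elim] by (simp add: gradient_def I_def algebra_simps)
  qed
  have M: "I i j \<in> borel_measurable lebesgue" for i j using I_int by (rule borel_measurable_integrable)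
  have "(LINT z|lebesgue. (block_diag a b *v grad_qp z - block_diag b a *v grad_qm z) \<bullet> gradient \<phi> z)
      = (LINT z|lebesgue. I 1 3 z + I 1 4 z + I 2 3 z + I 2 4 z)"
  proof (rule integral_cong_AE[OF _ _ ae])
    show m: "(\<lambda>z. I 1 3 z + I 1 4 z + I 2 3 z + I 2 4 z) \<in> borel_measurable lebesgue"
      by (intro borel_measurable_add M)
    have ae': "AE z in lebesgue. I 1 3 z + I 1 4 z + I 2 3 z + I 2 4 z
        = (block_diag a b *v grad_qp z - block_diag b a *v grad_qm z) \<bullet> gradient \<phi> z"
      using ae by (rule eventually_mono) (rule sym)
    \<comment> \<open>Measurability is inherited from the sum of the pairs, with which the pairing
      agrees almost everywhere.\<close>
    show "(\<lambda>z. (block_diag a b *v grad_qp z - block_diag b a *v grad_qm z) \<bullet> gradient \<phi> z) \<in> borel_measurable lebesgue"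
      by (rule borel_measurable_AE[OF m ae'])
  qed
  also have "\<dots> = 0"
    using I_int by (simp add: I0)
  finally show "(LINT z|lebesgue. (block_diag a b *v grad_qp z - block_diag b a *v grad_qm z) \<bullet> gradient \<phi> z) = 0" .
qed

lemma sign_cases:
  "sqy z < sqx z \<Longrightarrow> 0 < qp z" "sqx z < sqy z \<Longrightarrow> 0 < qm z"
  using qp_eq(1)[of z] qm_eq(1)[of z] profile_f_pos[of "sqy z" "sqx z"] profile_f_pos[of "sqx z" "sqy z"] by simp_all

text \<open>Both functions are nonnegative and at each point at least one of them vanishes.\<close>

lemma q_parts: "pos_part q = qp" "neg_part q = qm"
proof -
  have "max (q z) 0 = qp z \<and> max (- q z) 0 = qm z" for z
  proof -
    consider "sqy z < sqx z" | "sqx z < sqy z" | "sqx z = sqy z" by linarith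
    then show ?thesis
      using sign_cases[of z] qp_eq(2)[of z] qm_eq(2)[of z] by cases (simp_all add: q_def)
  qed
  then show "pos_part q = qp" "neg_part q = qm" by (auto simp: pos_part_def neg_part_def fun_eq_iff)
qed

lemma q_two_phase: "two_phase_solution (block_diag a b) (block_diag b a) q"
  unfolding two_phase_solution_def q_parts
  using qp_weak_gradient qm_weak_gradient distributional_div_zero_flux by blast

lemma q_eq_0_iff: "q z = 0 \<longleftrightarrow> sqx z = sqy z"
proof -
  consider "sqy z < sqx z" | "sqx z < sqy z" | "sqx z = sqy z" by linarith
  then show ?thesis
    using sign_cases[of z] qp_eq(2)[of z] qm_eq(2)[of z] by cases (simp_all add: q_def)
qed

lemma q_homogeneous: "homogeneous (2 * \<alpha>) q"
  using qp_homogeneous qm_homogeneous by (simp add: homogeneous_def q_def right_diff_distrib)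

section \<open>Continuous differentiability away from the origin\<close>

definition grad_q :: "real^4 \<Rightarrow> real^4" where
  "grad_q z = (if sqy z - sqx z \<le> 0 then bgrad z (ur (sqx z) (sqy z)) (us (sqx z) (sqy z))
     else - bgrad z (us (sqy z) (sqx z)) (ur (sqy z) (sqx z)))"

lemma bgrad_match:
  assumes "sqx z = sqy z" "0 < sqx z"
  shows "bgrad z (ur (sqx z) (sqy z)) (us (sqx z) (sqy z)) = - bgrad z (us (sqy z) (sqx z)) (ur (sqy z) (sqx z))"
  using gradient_match[OF assms(2)] assms(1) by (simp add: vec_eq_iff forall_4)

text \<open>On the cone q agrees on each closed side with a function that is differentiable in a
  full sense; the two derivatives coincide by \<open>bgrad_match\<close>, and the two sides cover
  the space.\<close>

lemma q_has_derivative: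
  assumes "z \<noteq> 0"
  shows "(q has_derivative (\<lambda>v. grad_q z \<bullet> v)) (at z)"
proof (cases "sqx z = sqy z")
  case False
  have "(q has_derivative (\<lambda>v. grad_qp z \<bullet> v - grad_qm z \<bullet> v)) (at z)"
    unfolding q_def[abs_def]
    by (rule has_derivative_diff[OF qp_has_derivative[OF False] qm_has_derivative[OF False]])
  moreover have "grad_q z = grad_qp z - grad_qm z"
    using False by (auto simp: grad_q_def grad_qp_def grad_qm_def)
  ultimately show ?thesis by (simp add: inner_diff_left)
next
  case True
  then have pos: "0 < sqx z" "0 < sqy z" using sq_sum_pos[OF assms] by auto
  have g1: "grad_q z = bgrad z (ur (sqx z) (sqy z)) (us (sqx z) (sqy z))"
    unfolding grad_q_def using True by simp
  have g2: "grad_q z = - bgrad z (us (sqy z) (sqx z)) (ur (sqy z) (sqx z))"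
    unfolding g1 by (rule bgrad_match[OF True pos(1)])
  have q1: "q w = profile a b \<alpha> f (sqx w) (sqy w)" if "sqy w \<le> sqx w" for w
    unfolding q_def qp_eq(1)[OF that] qm_eq(2)[OF that] by simp
  have q2: "q w = - profile a b \<alpha> f (sqy w) (sqx w)" if "sqx w \<le> sqy w" for w
    unfolding q_def qp_eq(2)[OF that] qm_eq(1)[OF that] by simp
  have "((\<lambda>z. profile a b \<alpha> f (sqx z) (sqy z)) has_derivative (\<lambda>v. grad_q z \<bullet> v)) (at z)"
    unfolding g1 using profile_f_has_derivative(1)[OF eq_refl[OF True[symmetric]] pos(1)] .
  then have 1: "(q has_derivative (\<lambda>v. grad_q z \<bullet> v)) (at z within {z. sqy z \<le> sqx z})"
    by (rule has_derivative_transform[OF _ _ has_derivative_at_withinI, rotated 2])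
      (use True q1 in simp_all)
  have "((\<lambda>z. - profile a b \<alpha> f (sqy z) (sqx z)) has_derivative (\<lambda>v. grad_q z \<bullet> v)) (at z)"
    unfolding g2 inner_minus_left
    by (rule has_derivative_minus[OF profile_f_has_derivative(2)[OF eq_refl[OF True] pos(2)]])
  then have 2: "(q has_derivative (\<lambda>v. grad_q z \<bullet> v)) (at z within {z. sqx z \<le> sqy z})"
    by (rule has_derivative_transform[OF _ _ has_derivative_at_withinI, rotated 2])
      (use True q2 in simp_all)
  have "{z. sqy z \<le> sqx z} \<union> {z. sqx z \<le> sqy z} = UNIV" by auto
  then show ?thesis using has_derivative_within_Un[OF 1 2] by simp
qed

lemma profile_derivs_continuous:
  assumes "continuous_on X R" "continuous_on X S"
    and "\<And>z. z \<in> X \<Longrightarrow> 0 \<le> S z" "\<And>z. z \<in> X \<Longrightarrow> S z \<le> R z" "\<And>z. z \<in> X \<Longrightarrow> 0 < R z"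
  shows "continuous_on X (\<lambda>z. ur (R z) (S z))" "continuous_on X (\<lambda>z. us (R z) (S z))"
proof -
  have P: "0 < b * R z + a * S z" and W: "a * S z / (b * R z + a * S z) \<in> {0..a}" if "z \<in> X" for z
    using weight_range[of "S z" "R z"] assms(3-5)[OF that] by auto
  have cP: "continuous_on X (\<lambda>z. b * R z + a * S z)" by (intro continuous_intros assms)
  have cW: "continuous_on X (\<lambda>z. a * S z / (b * R z + a * S z))"
    using P by (intro continuous_intros assms cP) fastforce
  have cp: "continuous_on X (\<lambda>z. (b * R z + a * S z) powr (\<alpha> - 1))"
    using P by (intro continuous_on_powr cP continuous_on_const) fastforce
  have cf: "continuous_on X (\<lambda>z. f (a * S z / (b * R z + a * S z)))"
    "continuous_on X (\<lambda>z. f1 (a * S z / (b * R z + a * S z)))"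
    using W by (auto intro!: continuous_on_compose2[OF f_continuous(1) cW] continuous_on_compose2[OF f_continuous(2) cW])
  show "continuous_on X (\<lambda>z. ur (R z) (S z))" "continuous_on X (\<lambda>z. us (R z) (S z))"
    unfolding profile_r_def profile_s_def by (intro continuous_intros cp cf cW)+
qed

lemma bgrad_nth_continuous:
  assumes "continuous_on X p" "continuous_on X r"
  shows "continuous_on X (\<lambda>z. bgrad z (p z) (r z) $ i)"
proof -
  have "continuous_on X (\<lambda>z. 2 * p z * z $ k)" "continuous_on X (\<lambda>z. 2 * r z * z $ k)" for k
    by (intro continuous_intros assms)+
  then show ?thesis using exhaust_4[of i] by (elim disjE) (simp_all only: bgrad_nth)
qed

lemma grad_q_continuous: "continuous_on (UNIV - {0}) (\<lambda>z. grad_q z $ i)"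
proof -
  let ?A = "{z \<in> UNIV - {0}. sqy z - sqx z \<le> 0}" and ?B = "{z \<in> UNIV - {0}. 0 \<le> sqy z - sqx z}"
  have posA: "0 < sqx z" if "z \<in> ?A" for z using sq_sum_pos[of z] that by auto
  have posB: "0 < sqy z" if "z \<in> ?B" for z using sq_sum_pos[of z] that by auto
  have A: "continuous_on ?A (\<lambda>z. ur (sqx z) (sqy z))" "continuous_on ?A (\<lambda>z. us (sqx z) (sqy z))"
    using posA by (auto intro!: profile_derivs_continuous continuous_on_sq)
  have B: "continuous_on ?B (\<lambda>z. ur (sqy z) (sqx z))" "continuous_on ?B (\<lambda>z. us (sqy z) (sqx z))"
    using posB by (auto intro!: profile_derivs_continuous continuous_on_sq)
  have cA: "continuous_on ?A (\<lambda>z. bgrad z (ur (sqx z) (sqy z)) (us (sqx z) (sqy z)) $ i)"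
    by (rule bgrad_nth_continuous[OF A])
  have cB: "continuous_on ?B (\<lambda>z. (- bgrad z (us (sqy z) (sqx z)) (ur (sqy z) (sqx z))) $ i)"
    unfolding vector_uminus_component by (intro continuous_on_minus bgrad_nth_continuous B)
  have m: "bgrad z (ur (sqx z) (sqy z)) (us (sqx z) (sqy z)) $ i = (- bgrad z (us (sqy z) (sqx z)) (ur (sqy z) (sqx z))) $ i"
    if "z \<in> UNIV - {0}" "sqy z - sqx z = 0" for z
    using bgrad_match[of z] posA[of z] that by simp
  have "continuous_on (UNIV - {0}) (\<lambda>z. sqy z - sqx z)"
    by (intro continuous_intros continuous_on_sq)
  \<comment> \<open>The case condition in \<open>grad_q\<close> compares a difference with 0 to fit
    this pasting lemma, whose pieces are closed in the punctured space.\<close>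
  from continuous_on_cases_le[OF cA cB this m]
  show ?thesis unfolding grad_q_def if_distrib[of "\<lambda>v. v $ i"] .
qed

lemma q_C1: "Ck_on 1 (UNIV - {0}) q"
proof -
  have "partial_deriv i q z = grad_q z $ i" if "z \<noteq> 0" for i z
    unfolding partial_deriv_def frechet_derivative_at[OF q_has_derivative[OF that], symmetric]
    by (simp add: inner_axis)
  then have "continuous_on (UNIV - {0}) (partial_deriv i q)" for i
    using continuous_on_cong[of "UNIV - {0}" "UNIV - {0}" "partial_deriv i q" "\<lambda>z. grad_q z $ i"]
      grad_q_continuous[of i] by simp
  moreover have "q differentiable (at z)" if "z \<noteq> 0" for z
    using q_has_derivative[OF that] by (auto simp: differentiable_def)
  ultimately show ?thesis unfolding One_nat_def Ck_on.simps by blast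
qed

end

section \<open>Choice of the parameters and conclusion\<close>

theorem corollary2p5:
  fixes \<sigma> :: real
  assumes "0 < \<sigma>" and "\<sigma> < 1"
  shows "\<exists>(Ap :: real^4^4) (Am :: real^4^4) (q :: real^4 \<Rightarrow> real).
           symmetric_matrix Ap \<and> symmetric_matrix Am \<and>
           uniformly_elliptic Ap \<and> uniformly_elliptic Am \<and>
           \<not> proportional Ap Am \<and>
           (\<exists>z. q z \<noteq> 0) \<and>
           holder_loc \<sigma> q \<and> W12_loc q \<and>
           homogeneous \<sigma> q \<and>
           two_phase_solution Ap Am q \<and>
           {z. q z = 0} = {z. norm (x_part z) = norm (y_part z)} \<and>
           Ck_on 1 (UNIV - {0}) q \<and>
           (\<forall>\<beta>>\<sigma>. \<not> holder_at_origin \<beta> q)"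
proof -
  \<comment> \<open>The solution has degree 2 \<alpha> in z, because the profile depends on squared
    radii.\<close>
  define \<alpha> where "\<alpha> = \<sigma> / 2"
  define c where "c = \<alpha> * (\<alpha> + 1)"
  have \<alpha>\<sigma>: "0 < \<alpha>" "\<alpha> < 1 / 2" "2 * \<alpha> = \<sigma>" using assms by (auto simp: \<alpha>_def)
  have "\<alpha> * (\<alpha> + 1) \<le> (1/2) * (3/2)" using \<alpha>\<sigma> by (intro mult_mono) auto
  then have c: "0 < c" "c < 1" using \<alpha>\<sigma> by (auto simp: c_def)
  \<comment> \<open>The zero of the Legendre function serves as the matrix entry a; a \<noteq> 1/2
    makes a and 1 - a distinct and the matrices nonproportional.\<close>
  obtain a where a: "0 < a" "a < 1" "a \<noteq> 1 / 2" "legendre c a = 0"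
    using legendre_zero[OF c] by blast
  interpret cone_profile \<alpha> a "1 - a" c
    by unfold_locales (use \<alpha>\<sigma> a in \<open>auto simp: c_def\<close>)
  have ne: "a \<noteq> 1 - a" using a(3) by auto
  \<comment> \<open>This unit vector has y = 0 and lies off the cone; it also provides the ray for
    the failure of higher regularity.\<close>
  have z1: "q (axis 1 1) \<noteq> 0"
    by (simp add: q_eq_0_iff sqx_def sqy_def axis_def)
  have q0: "q 0 = 0" by (simp add: q_eq_0_iff)
  have zs: "{z. q z = 0} = {z. norm (x_part z) = norm (y_part z)}"
    by (simp add: q_eq_0_iff norm_x_part norm_y_part)
  have hol: "holder_loc \<sigma> q"
  proof -
    obtain C where "homogeneous_lipschitz \<sigma> C q"
      using q_homogeneous_lipschitz unfolding \<alpha>\<sigma>(3) ..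
    then show ?thesis using assms by (rule homogeneous_lipschitz_holder)
  qed
  have hom: "homogeneous \<sigma> q" using q_homogeneous unfolding \<alpha>\<sigma>(3) .
  show ?thesis
  proof (intro exI conjI allI impI)
    show "symmetric_matrix (block_diag a (1 - a))" "symmetric_matrix (block_diag (1 - a) a)"
      by (rule block_diag_symmetric)+
    show "uniformly_elliptic (block_diag a (1 - a))" "uniformly_elliptic (block_diag (1 - a) a)"
      by (intro block_diag_elliptic ab)+
    show "\<not> proportional (block_diag a (1 - a)) (block_diag (1 - a) a)"
      by (intro block_diag_not_proportional ab ne)
    show "\<not> holder_at_origin \<beta> q" if "\<sigma> < \<beta>" for \<beta>
      by (rule homogeneous_not_holder_at_origin[OF hom q0 z1 that])
  qed (fact z1 hol q_W12 hom q_two_phase zs q_C1)+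
qed

end
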